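(* If $R\to S$ is a module-finite extension of complete local domains of mixed characteristic $p$ with an $F$-finite residue field, then the map $R\to S$ is $\mathsf{epf}$-phantom.
   Context: Local rings are Noetherian; an extension is an injective ring homomorphism. A ring of mixed characteristic $p$ ($p$ a positive prime integer) is a ring of characteristic $0$ with $p$ in every maximal ideal. A field $k$ of characteristic $p$ is $F$-finite if $[k:k^p]<\infty$. For a domain $R$, $R^+$ denotes an absolute integral closure of $R$, i.e. the integral closure of $R$ in an algebraic closure of its fraction field. For an $R$-module $M$ write $M^+=R^+\otimes_R M$. For $c\in R^+$ and a positive rational $\varepsilon=a/b$, $c^{\varepsilon}$ denotes the $a$-th power of a $b$-th root of $c$ in $R^+$ (well defined up to a unit of $R^+$). For finitely generated $R$-modules $W\subseteq M$, an element $u\in M$ is in the $\mathsf{epf}$ closure $W^{\mathsf{epf}}_M$ if there is $c\in R\setminus\{0\}$ such that for all $\varepsilon\in\mathbb{Q}^+$ and all positive integers $N$, $c^{\varepsilon}\otimes u\in \operatorname{Im}(W^+\to M^+)+p^NM^+$. Phantom: let $\alpha:R\to M$ be an injective $R$-linear map with $M$ a finitely generated $R$-module, and let $Q=M/\alpha(R)$. The exact sequence $0\to R\xrightarrow{\alpha} M\to Q\to 0$ determines an element of $\operatorname{Ext}^1_R(Q,R)$ via the Yoneda correspondence. Let $P_\bullet$ be a projective resolution of $Q$ by finitely generated projective $R$-modules $P_i$, and let $\epsilon\in \operatorname{Hom}_R(P_1,R)$ be a cocycle representing this element. The map $\alpha$ is called $\mathsf{epf}$-phantom if $\epsilon\in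 \left(\operatorname{Im}(\operatorname{Hom}_R(P_0,R)\to \operatorname{Hom}_R(P_1,R))\right)^{\mathsf{epf}}_{\operatorname{Hom}_R(P_1,R)}$; this is independent of the choice of $P_\bullet$. Here it is applied with $M=S$ viewed as an $R$-module. *)

theory Defs
  imports
    "HOL-Computational_Algebra.Primes"
    "HOL-Algebra.Algebraic_Closure"
    "HOL-Algebra.Free_Abelian_Groups"
    "HOL-Algebra.Generated_Fields"
    "HOL-Algebra.Ideal_Product"
    "HOL-Algebra.QuotRing"
begin

section \<open>Complete local rings of mixed characteristic\<close>

definition local_ring :: "('a, 'x) ring_scheme \<Rightarrow> bool" where
  "local_ring R \<longleftrightarrow> cring R \<and> noetherian_ring R \<and> (\<exists>!m. maximalideal m R)"

definition max_ideal :: "('a, 'x) ring_scheme \<Rightarrow> 'a set" where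
  "max_ideal R = (THE m. maximalideal m R)"

definition residue_field :: "('a, 'x) ring_scheme \<Rightarrow> 'a set ring" where
  "residue_field R = R Quot (max_ideal R)"

text \<open>The canonical map from the local ring \<open>R\<close> with maximal ideal \<open>m\<close> to the inverse
  limit of the rings \<open>R / m^n\<close> is bijective: the first conjunct is injectivity, the second is
  surjectivity. The power \<open>m^n\<close> is taken in the monoid of ideals, so \<open>m^0 = R\<close>.\<close>

definition complete_local_ring :: "('a, 'x) ring_scheme \<Rightarrow> bool" where
  "complete_local_ring R \<longleftrightarrow> local_ring R \<and>
     (\<Inter>n::nat. max_ideal R [^]\<^bsub>ideals_set R\<^esub> n) = {\<zero>\<^bsub>R\<^esub>} \<and>
     (\<forall>x::nat \<Rightarrow> 'a. (\<forall>n. x n \<in> carrier R) \<and>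
        (\<forall>n. x (Suc n) \<ominus>\<^bsub>R\<^esub> x n \<in> max_ideal R [^]\<^bsub>ideals_set R\<^esub> n) \<longrightarrow>
        (\<exists>l\<in>carrier R. \<forall>n. x n \<ominus>\<^bsub>R\<^esub> l \<in> max_ideal R [^]\<^bsub>ideals_set R\<^esub> n))"

definition mixed_characteristic :: "('a, 'x) ring_scheme \<Rightarrow> nat \<Rightarrow> bool" where
  "mixed_characteristic R p \<longleftrightarrow> Factorial_Ring.prime p \<and>
     (\<forall>n::nat. n > 0 \<longrightarrow> [n] \<cdot>\<^bsub>R\<^esub> \<one>\<^bsub>R\<^esub> \<noteq> \<zero>\<^bsub>R\<^esub>) \<and>
     (\<forall>m. maximalideal m R \<longrightarrow> [p] \<cdot>\<^bsub>R\<^esub> \<one>\<^bsub>R\<^esub> \<in> m)"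

definition F_finite :: "('a, 'x) ring_scheme \<Rightarrow> nat \<Rightarrow> bool" where
  "F_finite k p \<longleftrightarrow>
     ring.finite_dimension k ((\<lambda>x. x [^]\<^bsub>k\<^esub> p) ` carrier k) (carrier k)"


section \<open>Modules\<close>

text \<open>The type of modules extends that of rings, but the fields \<^const>\<open>mult\<close> and \<^const>\<open>one\<close>
  play no role in the locale \<^locale>\<open>module\<close>; they are left unspecified where there is no natural
  choice.\<close>

definition restrict_scalars ::
    "('b, 'y) ring_scheme \<Rightarrow> ('a \<Rightarrow> 'b) \<Rightarrow> ('a, 'b) module" where
  "restrict_scalars S f =
     \<lparr>carrier = carrier S, mult = monoid.mult S, one = \<one>\<^bsub>S\<^esub>, Ring.ring.zero = \<zero>\<^bsub>S\<^esub>, add = ring.add S,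
      smult = (\<lambda>r s. f r \<otimes>\<^bsub>S\<^esub> s)\<rparr>"

definition regular_module :: "('a, 'x) ring_scheme \<Rightarrow> ('a, 'a) module" where
  "regular_module R = restrict_scalars R id"

definition finitely_generated :: "('a, 'x) ring_scheme \<Rightarrow> ('a, 'm) module \<Rightarrow> bool" where
  "finitely_generated R M \<longleftrightarrow>
     (\<exists>A. finite A \<and> A \<subseteq> carrier M \<and>
          (\<forall>N. submodule N R M \<and> A \<subseteq> N \<longrightarrow> N = carrier M))"

definition mod_hom ::
    "('a, 'x) ring_scheme \<Rightarrow> ('a, 'm) module \<Rightarrow> ('a, 'n) module \<Rightarrow> ('m \<Rightarrow> 'n) set" where
  "mod_hom R M N =
     {g \<in> carrier M \<rightarrow> carrier N.
        (\<forall>x\<in>carrier M. \<forall>y\<in>carrier M. g (x \<oplus>\<^bsub>M\<^esub> y) = g x \<oplus>\<^bsub>N\<^esub> g y) \<and>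
        (\<forall>r\<in>carrier R. \<forall>x\<in>carrier M. g (r \<odot>\<^bsub>M\<^esub> x) = r \<odot>\<^bsub>N\<^esub> g x)}"

definition hom_module ::
    "('a, 'x) ring_scheme \<Rightarrow> ('a, 'm) module \<Rightarrow> ('a, 'n) module \<Rightarrow> ('a, 'm \<Rightarrow> 'n) module" where
  "hom_module R M N =
     \<lparr>carrier = mod_hom R M N \<inter> extensional (carrier M),
      mult = undefined, one = undefined,
      Ring.ring.zero = (\<lambda>x\<in>carrier M. \<zero>\<^bsub>N\<^esub>),
      add = (\<lambda>g h. \<lambda>x\<in>carrier M. g x \<oplus>\<^bsub>N\<^esub> h x),
      smult = (\<lambda>r g. \<lambda>x\<in>carrier M. r \<odot>\<^bsub>N\<^esub> g x)\<rparr>"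

definition quotient_module :: "('a, 'm) module \<Rightarrow> 'm set \<Rightarrow> ('a, 'm set) module" where
  "quotient_module M N =
     \<lparr>carrier = a_rcosets\<^bsub>M\<^esub> N, mult = undefined, one = undefined, Ring.ring.zero = N, add = set_add M,
      smult = (\<lambda>r C. \<Union>x\<in>C. N +>\<^bsub>M\<^esub> (r \<odot>\<^bsub>M\<^esub> x))\<rparr>"

definition free_module :: "('a, 'x) ring_scheme \<Rightarrow> 'i set \<Rightarrow> ('a, 'i \<Rightarrow> 'a) module" where
  "free_module R I =
     \<lparr>carrier = {v \<in> I \<rightarrow>\<^sub>E carrier R. finite {i \<in> I. v i \<noteq> \<zero>\<^bsub>R\<^esub>}},
      mult = undefined, one = undefined,
      Ring.ring.zero = (\<lambda>i\<in>I. \<zero>\<^bsub>R\<^esub>),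
      add = (\<lambda>v w. \<lambda>i\<in>I. v i \<oplus>\<^bsub>R\<^esub> w i),
      smult = (\<lambda>r v. \<lambda>i\<in>I. r \<otimes>\<^bsub>R\<^esub> v i)\<rparr>"

text \<open>A module is projective if it is a direct summand of a free module. Index sets inside the
  type of elements of \<open>P\<close> suffice, since a projective \<open>P\<close> is a summand of the free module on
  the set of its own elements.\<close>

definition projective_module :: "('a, 'x) ring_scheme \<Rightarrow> ('a, 'm) module \<Rightarrow> bool" where
  "projective_module R P \<longleftrightarrow> module R P \<and>
     (\<exists>(I::'m set) s r. s \<in> mod_hom R P (free_module R I) \<and> r \<in> mod_hom R (free_module R I) P \<and>
        (\<forall>x\<in>carrier P. r (s x) = x))"

text \<open>The exact sequence \<open>\<dots> \<rightarrow> P 2 \<rightarrow> P 1 \<rightarrow> P 0 \<rightarrow> Q \<rightarrow> 0\<close> with \<open>d i : P (i + 1) \<rightarrow> P i\<close> and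
  augmentation \<open>a : P 0 \<rightarrow> Q\<close>.\<close>

definition fg_projective_resolution ::
    "('a, 'x) ring_scheme \<Rightarrow> ('a, 'q) module \<Rightarrow> (nat \<Rightarrow> ('a, 'm) module) \<Rightarrow>
     (nat \<Rightarrow> 'm \<Rightarrow> 'm) \<Rightarrow> ('m \<Rightarrow> 'q) \<Rightarrow> bool" where
  "fg_projective_resolution R Q P d a \<longleftrightarrow>
     (\<forall>i. projective_module R (P i) \<and> finitely_generated R (P i)) \<and>
     a \<in> mod_hom R (P 0) Q \<and> (\<forall>i. d i \<in> mod_hom R (P (Suc i)) (P i)) \<and>
     a ` carrier (P 0) = carrier Q \<and>
     d 0 ` carrier (P 1) = a_kernel (P 0) Q a \<and>
     (\<forall>i. d (Suc i) ` carrier (P (Suc (Suc i))) = a_kernel (P (Suc i)) (P i) (d i))"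


section \<open>Absolute integral closure\<close>

text \<open>\<open>L\<close>, together with the embedding \<open>\<iota> : R \<rightarrow> L\<close>, is an algebraic closure of the fraction field
  of the domain \<open>R\<close>; the fraction field is realised as the subfield of \<open>L\<close> generated by the
  image of \<open>R\<close>.\<close>

definition alg_closure_of_fractions ::
    "('a, 'x) ring_scheme \<Rightarrow> ('l, 'z) ring_scheme \<Rightarrow> ('a \<Rightarrow> 'l) \<Rightarrow> bool" where
  "alg_closure_of_fractions R L \<iota> \<longleftrightarrow>
     \<iota> \<in> ring_hom R L \<and> inj_on \<iota> (carrier R) \<and>
     algebraic_closure L (generate_field L (\<iota> ` carrier R))"

definition integral_over :: "('l, 'z) ring_scheme \<Rightarrow> 'l set \<Rightarrow> 'l \<Rightarrow> bool" where
  "integral_over L A x \<longleftrightarrow>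
     (\<exists>q\<in>carrier (univ_poly L A). q \<noteq> [] \<and> lead_coeff q = \<one>\<^bsub>L\<^esub> \<and> ring.eval L q x = \<zero>\<^bsub>L\<^esub>)"

definition abs_integral_closure ::
    "('a, 'x) ring_scheme \<Rightarrow> ('l, 'z) ring_scheme \<Rightarrow> ('a \<Rightarrow> 'l) \<Rightarrow> ('l, 'z) ring_scheme" where
  "abs_integral_closure R L \<iota> =
     L\<lparr>carrier := {x \<in> carrier L. integral_over L (\<iota> ` carrier R) x}\<rparr>"

text \<open>\<open>z\<close> is a value of \<open>c\<^sup>\<epsilon>\<close> in \<open>A\<close>: for some expression of \<open>\<epsilon>\<close> as \<open>a / b\<close> it is the
  \<open>a\<close>-th power of a \<open>b\<close>-th root of \<open>c\<close>.\<close>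

definition is_rat_power :: "('l, 'z) ring_scheme \<Rightarrow> 'l \<Rightarrow> rat \<Rightarrow> 'l \<Rightarrow> bool" where
  "is_rat_power A c \<epsilon> z \<longleftrightarrow>
     (\<exists>a b :: nat. \<exists>t\<in>carrier A. a > 0 \<and> b > 0 \<and> \<epsilon> = of_nat a / of_nat b \<and>
        t [^]\<^bsub>A\<^esub> b = c \<and> z = t [^]\<^bsub>A\<^esub> a)"


section \<open>Base change of modules\<close>

text \<open>For a ring homomorphism \<open>\<iota> : R \<rightarrow> A\<close> and an \<open>R\<close>-module \<open>M\<close>, the tensor product
  of \<open>A\<close> and \<open>M\<close> over \<open>R\<close> is constructed as an abelian group (written multiplicatively): the
  free abelian group on pairs \<open>(b, m)\<close> modulo the subgroup generated by the bilinearity relations.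
  The \<open>A\<close>-module structure is not recorded, as only multiplication by integers is needed.\<close>

definition tensor_free ::
    "('l, 'z) ring_scheme \<Rightarrow> ('a, 'm) module \<Rightarrow> (('l \<times> 'm) \<Rightarrow>\<^sub>0 int) monoid" where
  "tensor_free A M = free_Abelian_group (carrier A \<times> carrier M)"

definition tensor_relations ::
    "('a, 'x) ring_scheme \<Rightarrow> ('l, 'z) ring_scheme \<Rightarrow> ('a \<Rightarrow> 'l) \<Rightarrow> ('a, 'm) module \<Rightarrow>
     (('l \<times> 'm) \<Rightarrow>\<^sub>0 int) set" where
  "tensor_relations R A \<iota> M = generate (tensor_free A M)
     ({frag_of (b \<oplus>\<^bsub>A\<^esub> b', m) - frag_of (b, m) - frag_of (b', m) | b b' m.
         b \<in> carrier A \<and> b' \<in> carrier A \<and> m \<in> carrier M} \<union>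
      {frag_of (b, m \<oplus>\<^bsub>M\<^esub> m') - frag_of (b, m) - frag_of (b, m') | b m m'.
         b \<in> carrier A \<and> m \<in> carrier M \<and> m' \<in> carrier M} \<union>
      {frag_of (b \<otimes>\<^bsub>A\<^esub> \<iota> r, m) - frag_of (b, r \<odot>\<^bsub>M\<^esub> m) | b r m.
         b \<in> carrier A \<and> r \<in> carrier R \<and> m \<in> carrier M})"

definition base_change ::
    "('a, 'x) ring_scheme \<Rightarrow> ('l, 'z) ring_scheme \<Rightarrow> ('a \<Rightarrow> 'l) \<Rightarrow> ('a, 'm) module \<Rightarrow>
     (('l \<times> 'm) \<Rightarrow>\<^sub>0 int) set monoid" where
  "base_change R A \<iota> M = tensor_free A M Mod tensor_relations R A \<iota> M"

definition pure_tensor ::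
    "('a, 'x) ring_scheme \<Rightarrow> ('l, 'z) ring_scheme \<Rightarrow> ('a \<Rightarrow> 'l) \<Rightarrow> ('a, 'm) module \<Rightarrow>
     'l \<Rightarrow> 'm \<Rightarrow> (('l \<times> 'm) \<Rightarrow>\<^sub>0 int) set" where
  "pure_tensor R A \<iota> M b m = tensor_relations R A \<iota> M #>\<^bsub>tensor_free A M\<^esub> frag_of (b, m)"

text \<open>The map induced on base changes by \<open>g : M \<rightarrow> N\<close>, sending the class of a formal sum of
  pairs \<open>(b, m)\<close> to the class of the corresponding sum of pairs \<open>(b, g m)\<close>.\<close>

definition base_change_map ::
    "('a, 'x) ring_scheme \<Rightarrow> ('l, 'z) ring_scheme \<Rightarrow> ('a \<Rightarrow> 'l) \<Rightarrow> ('a, 'n) module \<Rightarrow>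
     ('m \<Rightarrow> 'n) \<Rightarrow> (('l \<times> 'm) \<Rightarrow>\<^sub>0 int) set \<Rightarrow> (('l \<times> 'n) \<Rightarrow>\<^sub>0 int) set" where
  "base_change_map R A \<iota> N g C =
     (\<Union>x\<in>C. tensor_relations R A \<iota> N #>\<^bsub>tensor_free A N\<^esub>
               frag_extend (\<lambda>(b, m). frag_of (b, g m)) x)"


section \<open>The epf closure and epf-phantom maps\<close>

text \<open>Here \<open>L\<close> and \<open>\<iota>\<close> are as in \<open>alg_closure_of_fractions\<close>, and \<open>W\<close> is a submodule of the
  \<open>R\<close>-module \<open>M\<close>. Since the values of \<open>c\<^sup>\<epsilon>\<close> differ by units, all of them may be
  required to satisfy the membership condition. Integer multiples in the base change of \<open>M\<close> are
  powers in multiplicative notation, and \<open><#>\<close> is the sum of subgroups.\<close>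

definition epf_closure ::
    "nat \<Rightarrow> ('a, 'x) ring_scheme \<Rightarrow> ('l, 'z) ring_scheme \<Rightarrow> ('a \<Rightarrow> 'l) \<Rightarrow>
     ('a, 'm) module \<Rightarrow> 'm set \<Rightarrow> 'm set" where
  "epf_closure p R L \<iota> M W =
     (let A = abs_integral_closure R L \<iota>;
          Mplus = base_change R A \<iota> M;
          Wplus = base_change R A \<iota> (M\<lparr>carrier := W\<rparr>);
          Im = base_change_map R A \<iota> M (\<lambda>w. w) ` carrier Wplus
      in {u \<in> carrier M. \<exists>c\<in>carrier R - {\<zero>\<^bsub>R\<^esub>}.
            \<forall>\<epsilon>>0. \<forall>N>0. \<forall>z. is_rat_power A (\<iota> c) \<epsilon> z \<longrightarrow>
              pure_tensor R A \<iota> M z u \<in>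
                Im <#>\<^bsub>Mplus\<^esub> ((\<lambda>x. x [^]\<^bsub>Mplus\<^esub> (p ^ N)) ` carrier Mplus)})"

text \<open>Let \<open>Q\<close> be the cokernel of an injective map \<open>\<alpha> : R \<rightarrow> M\<close>. The cocycle
  \<open>\<eta> : P 1 \<rightarrow> R\<close> represents the class of \<open>0 \<rightarrow> R \<rightarrow> M \<rightarrow> Q \<rightarrow> 0\<close> in the first Ext group
  of \<open>Q\<close> by \<open>R\<close>: the identity of \<open>Q\<close> lifts to a map of complexes with components \<open>\<phi> : P 0 \<rightarrow> M\<close>
  and \<open>\<eta>\<close>. As \<open>\<phi>\<close> varies, \<open>\<eta>\<close> runs through the whole cohomology class. Conventions
  that put a sign here do not affect membership in a closure.\<close>

definition represents_extension ::
    "('a, 'x) ring_scheme \<Rightarrow> ('a, 'b) module \<Rightarrow> ('a \<Rightarrow> 'b) \<Rightarrow> (nat \<Rightarrow> ('a, 'm) module) \<Rightarrow>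
     (nat \<Rightarrow> 'm \<Rightarrow> 'm) \<Rightarrow> ('m \<Rightarrow> 'b set) \<Rightarrow> ('m \<Rightarrow> 'a) \<Rightarrow> bool" where
  "represents_extension R M \<alpha> P d a \<eta> \<longleftrightarrow>
     \<eta> \<in> carrier (hom_module R (P 1) (regular_module R)) \<and>
     (\<forall>x\<in>carrier (P 2). \<eta> (d 1 x) = \<zero>\<^bsub>R\<^esub>) \<and>
     (\<exists>\<phi>\<in>mod_hom R (P 0) M.
        (\<forall>x\<in>carrier (P 0). (\<alpha> ` carrier R) +>\<^bsub>M\<^esub> \<phi> x = a x) \<and>
        (\<forall>x\<in>carrier (P 1). \<alpha> (\<eta> x) = \<phi> (d 0 x)))"

definition coboundaries ::
    "('a, 'x) ring_scheme \<Rightarrow> (nat \<Rightarrow> ('a, 'm) module) \<Rightarrow> (nat \<Rightarrow> 'm \<Rightarrow> 'm) \<Rightarrow> ('m \<Rightarrow> 'a) set" where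
  "coboundaries R P d =
     (\<lambda>h. \<lambda>x\<in>carrier (P 1). h (d 0 x)) ` carrier (hom_module R (P 0) (regular_module R))"

text \<open>The type argument is the type of elements of the modules in the resolution, as a definition
  cannot quantify over types. The notion does not depend on the resolution, so all resolutions of
  that type and all representing cocycles are required to satisfy the condition. Over a Noetherian
  ring \<open>R\<close> with elements of type \<open>'a\<close>, the type \<open>nat \<Rightarrow> 'a\<close> always admits a resolution.\<close>

definition epf_phantom ::
    "'m itself \<Rightarrow> nat \<Rightarrow> ('a, 'x) ring_scheme \<Rightarrow> ('l, 'z) ring_scheme \<Rightarrow> ('a \<Rightarrow> 'l) \<Rightarrow>
     ('a, 'b) module \<Rightarrow> ('a \<Rightarrow> 'b) \<Rightarrow> bool" where
  "epf_phantom (_ :: 'm itself) p R L \<iota> M \<alpha> \<longleftrightarrow>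
     module R M \<and> finitely_generated R M \<and>
     \<alpha> \<in> mod_hom R (regular_module R) M \<and> inj_on \<alpha> (carrier R) \<and>
     (\<forall>(P :: nat \<Rightarrow> ('a, 'm) module) d a \<eta>.
        fg_projective_resolution R (quotient_module M (\<alpha> ` carrier R)) P d a \<and>
        represents_extension R M \<alpha> P d a \<eta> \<longrightarrow>
        \<eta> \<in> epf_closure p R L \<iota> (hom_module R (P 1) (regular_module R)) (coboundaries R P d))"

end

theory Submission
  imports Defs "HOL-Algebra.Chinese_Remainder"
begin

text \<open>
  The extension already becomes split after base change to \<open>R\<^sup>+\<close>, and this makes the cocycle a
  coboundary there.

  As \<open>S\<close> is a domain that is finite over \<open>R\<close>, the embedding of \<open>R\<close> into the algebraically closed field
  \<open>L\<close> extends to a ring homomorphism \<open>\<psi> : S \<rightarrow> L\<close> (\<open>extend_hom_to_alg_closed\<close>). Elements of \<open>S\<close> are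
  integral over \<open>R\<close>, so \<open>\<psi>\<close> takes values in \<open>R\<^sup>+\<close>; it is an \<open>R\<close>-linear map \<open>S \<rightarrow> R\<^sup>+\<close> that restricts to
  the inclusion of \<open>R\<close>, and it induces a retraction of \<open>R\<^sup>+ \<rightarrow> R\<^sup>+ \<otimes> S\<close>.

  Let \<open>\<eta> : P\<^sub>1 \<rightarrow> R\<close> represent the extension class, with \<open>\<phi> : P\<^sub>0 \<rightarrow> S\<close> satisfying \<open>f \<circ> \<eta> = \<phi> \<circ> d\<^sub>0\<close>.
  Then \<open>\<theta> = \<psi> \<circ> \<phi> : P\<^sub>0 \<rightarrow> R\<^sup>+\<close> satisfies \<open>\<theta> \<circ> d\<^sub>0 = \<iota> \<circ> \<eta>\<close>: over \<open>R\<^sup>+\<close> the cocycle is the coboundary of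
  \<open>\<theta>\<close>. Since \<open>P\<^sub>0\<close> and \<open>P\<^sub>1\<close> are finitely generated projective, they have finite dual bases, and these
  identify \<open>Hom(P\<^sub>i, R\<^sup>+)\<close> with \<open>R\<^sup>+ \<otimes> Hom(P\<^sub>i, R)\<close>. If \<open>g\<^sub>j, \<xi>\<^sub>j\<close> is a dual basis of \<open>P\<^sub>0\<close>, then
  \<open>\<theta> = \<Sum>\<^sub>j \<theta>(g\<^sub>j) \<xi>\<^sub>j\<close>, so that \<open>z \<otimes> \<eta> = \<Sum>\<^sub>j z \<theta>(g\<^sub>j) \<otimes> (\<xi>\<^sub>j \<circ> d\<^sub>0)\<close> in \<open>R\<^sup>+ \<otimes> Hom(P\<^sub>1, R)\<close> for every
  \<open>z \<in> R\<^sup>+\<close> (\<open>pullback_tensor_in_coboundaries\<close>). Thus \<open>z \<otimes> \<eta>\<close> lies in the image of \<open>R\<^sup>+ \<otimes> W\<close>, where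
  \<open>W\<close> is the module of coboundaries, and the condition defining the closure holds with \<open>c = 1\<close>.

  Both integrality and the ring structure of \<open>R\<^sup>+\<close> rest on one criterion: an element of a domain that
  maps the span of a finite set with a nonzero member into itself is integral
  (\<open>integral_over_if_stable\<close>).
\<close>

section \<open>Integral elements and stable finite sets\<close>

text \<open>The determinant trick needs only the degrees of the polynomials in \<open>x\<close> that occur. They are
  tracked through the sets of values at \<open>x\<close> of polynomials of degree below \<open>d\<close>, and of monic
  polynomials of degree \<open>d\<close>; an element may lie in several of these sets.\<close>

definition (in ring) polys_below :: "'a set \<Rightarrow> 'a \<Rightarrow> nat \<Rightarrow> 'a set" where
  "polys_below K x d = {eval p x | p. set p \<subseteq> K \<and> length p = d}"

definition (in ring) monic_values :: "'a set \<Rightarrow> 'a \<Rightarrow> nat \<Rightarrow> 'a set" where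
  "monic_values K x d = {x [^] d \<oplus> y | y. y \<in> polys_below K x d}"

inductive_set (in ring) lin_span :: "'a set \<Rightarrow> 'a set \<Rightarrow> 'a set" for K G where
  zero: "\<zero> \<in> lin_span K G"
| step: "\<lbrakk>a \<in> K; g \<in> G; y \<in> lin_span K G\<rbrakk> \<Longrightarrow> a \<otimes> g \<oplus> y \<in> lin_span K G"

context cring
begin

lemma polys_below_0: "polys_below K x 0 = {\<zero>}"
  by (auto simp: polys_below_def)

lemma polys_below_Suc:
  "polys_below K x (Suc d) = {a \<otimes> x [^] d \<oplus> y | a y. a \<in> K \<and> y \<in> polys_below K x d}"
proof (rule subset_antisym; rule subsetI)
  fix v assume "v \<in> polys_below K x (Suc d)"
  then obtain p where "set p \<subseteq> K" "length p = Suc d" "v = eval p x"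
    by (auto simp: polys_below_def)
  then show "v \<in> {a \<otimes> x [^] d \<oplus> y | a y. a \<in> K \<and> y \<in> polys_below K x d}"
    by (cases p) (auto simp: polys_below_def)
next
  fix v assume "v \<in> {a \<otimes> x [^] d \<oplus> y | a y. a \<in> K \<and> y \<in> polys_below K x d}"
  then obtain a p where "a \<in> K" "set p \<subseteq> K" "length p = d" "v = a \<otimes> x [^] d \<oplus> eval p x"
    by (auto simp: polys_below_def)
  then show "v \<in> polys_below K x (Suc d)"
    unfolding polys_below_def by (auto intro!: exI[of _ "a # p"])
qed

context
  fixes K x
  assumes K: "subring K R" and x: "x \<in> carrier R"
begin

lemmas base_ring_rules = subringE[OF K]

lemma base_ring_carrier: "a \<in> K \<Longrightarrow> a \<in> carrier R"
  using base_ring_rules(1) by auto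

lemma polys_below_carrier: "y \<in> polys_below K x d \<Longrightarrow> y \<in> carrier R"
  using eval_in_carrier[OF _ x] base_ring_carrier by (auto simp: polys_below_def)

lemma polys_below_mono1: "y \<in> polys_below K x d \<Longrightarrow> y \<in> polys_below K x (Suc d)"
proof -
  assume y: "y \<in> polys_below K x d"
  then have "\<zero> \<otimes> x [^] d \<oplus> y = y" using polys_below_carrier x by simp
  then show ?thesis unfolding polys_below_Suc using base_ring_rules(2) y by force
qed

lemma polys_below_mono: "d \<le> e \<Longrightarrow> y \<in> polys_below K x d \<Longrightarrow> y \<in> polys_below K x e"
  by (induction e rule: dec_induct) (auto intro: polys_below_mono1)

lemma polys_below_zero: "\<zero> \<in> polys_below K x d"
  using polys_below_mono[of 0 d \<zero>] by (simp add: polys_below_0)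

lemma polys_below_add:
  "y \<in> polys_below K x d \<Longrightarrow> z \<in> polys_below K x d \<Longrightarrow> y \<oplus> z \<in> polys_below K x d"
proof (induction d arbitrary: y z)
  case 0 then show ?case by (simp add: polys_below_0)
next
  case (Suc d)
  from Suc.prems obtain a y' b z' where *: "a \<in> K" "y' \<in> polys_below K x d" "y = a \<otimes> x [^] d \<oplus> y'"
    "b \<in> K" "z' \<in> polys_below K x d" "z = b \<otimes> x [^] d \<oplus> z'"
    by (auto simp: polys_below_Suc)
  then have c: "a \<in> carrier R" "b \<in> carrier R" "y' \<in> carrier R" "z' \<in> carrier R" "x [^] d \<in> carrier R"
    using base_ring_carrier polys_below_carrier x by auto
  have "y \<oplus> z = (a \<oplus> b) \<otimes> x [^] d \<oplus> (y' \<oplus> z')"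
    unfolding * using c by algebra
  moreover have "a \<oplus> b \<in> K" using * base_ring_rules(7) by auto
  ultimately show ?case using Suc.IH[of y' z'] * unfolding polys_below_Suc by blast
qed

lemma polys_below_smult:
  "y \<in> polys_below K x d \<Longrightarrow> k \<in> K \<Longrightarrow> k \<otimes> y \<in> polys_below K x d"
proof (induction d arbitrary: y)
  case 0 then show ?case using base_ring_carrier by (simp add: polys_below_0)
next
  case (Suc d)
  from Suc.prems obtain a y' where *: "a \<in> K" "y' \<in> polys_below K x d" "y = a \<otimes> x [^] d \<oplus> y'"
    by (auto simp: polys_below_Suc)
  then have c: "a \<in> carrier R" "k \<in> carrier R" "y' \<in> carrier R" "x [^] d \<in> carrier R"
    using base_ring_carrier polys_below_carrier x Suc.prems by auto
  have "k \<otimes> y = (k \<otimes> a) \<otimes> x [^] d \<oplus> (k \<otimes> y')"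
    unfolding * using c by algebra
  moreover have "k \<otimes> a \<in> K" using * base_ring_rules(6) Suc.prems by auto
  ultimately show ?case using Suc.IH[of y'] Suc.prems * unfolding polys_below_Suc by blast
qed

lemma polys_below_minus:
  assumes "y \<in> polys_below K x d" shows "\<ominus> y \<in> polys_below K x d"
proof -
  have "\<ominus> \<one> \<otimes> y = \<ominus> y" using polys_below_carrier[OF assms] by algebra
  then show ?thesis using polys_below_smult[OF assms, of "\<ominus> \<one>"] base_ring_rules(3,5) by auto
qed

lemma polys_below_shift1: "y \<in> polys_below K x d \<Longrightarrow> x \<otimes> y \<in> polys_below K x (Suc d)"
proof (induction d arbitrary: y)
  case 0 then show ?case using x polys_below_zero by (simp add: polys_below_0)
next
  case (Suc d)
  then obtain a y' where *: "a \<in> K" "y' \<in> polys_below K x d" "y = a \<otimes> x [^] d \<oplus> y'"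
    by (auto simp: polys_below_Suc)
  then have c: "a \<in> carrier R" "y' \<in> carrier R" "x [^] d \<in> carrier R"
    using base_ring_carrier polys_below_carrier x by auto
  have "x \<otimes> y = a \<otimes> x [^] (Suc d) \<oplus> (x \<otimes> y')"
    unfolding * nat_pow_Suc using c x by algebra
  with Suc.IH[of y'] * show ?case unfolding polys_below_Suc[of _ _ "Suc d"] by blast
qed

lemma polys_below_shift: "y \<in> polys_below K x d \<Longrightarrow> x [^] k \<otimes> y \<in> polys_below K x (k + d)"
proof (induction k)
  case 0 then show ?case using polys_below_carrier by simp
next
  case (Suc k)
  have "x [^] Suc k \<otimes> y = x \<otimes> (x [^] k \<otimes> y)"
    using polys_below_carrier[OF Suc.prems] x by (simp add: m_ac)
  then show ?case using polys_below_shift1[OF Suc.IH[OF Suc.prems]] by simp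
qed

lemma polys_below_mult:
  "y \<in> polys_below K x d \<Longrightarrow> z \<in> polys_below K x e \<Longrightarrow> y \<otimes> z \<in> polys_below K x (d + e)"
proof (induction d arbitrary: y)
  case 0 then show ?case using polys_below_zero polys_below_carrier by (simp add: polys_below_0)
next
  case (Suc d)
  then obtain a y' where *: "a \<in> K" "y' \<in> polys_below K x d" "y = a \<otimes> x [^] d \<oplus> y'"
    by (auto simp: polys_below_Suc)
  then have c: "a \<in> carrier R" "y' \<in> carrier R" "x [^] d \<in> carrier R" "z \<in> carrier R"
    using base_ring_carrier polys_below_carrier x Suc.prems by auto
  have "y \<otimes> z = a \<otimes> (x [^] d \<otimes> z) \<oplus> (y' \<otimes> z)"
    unfolding * using c by algebra
  then have "y \<otimes> z \<in> polys_below K x (d + e)"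
    using polys_below_add polys_below_smult[OF polys_below_shift] Suc.IH[of y'] * Suc.prems by auto
  then show ?case using polys_below_mono1 by simp
qed

lemma const_polys_below: "a \<in> K \<Longrightarrow> a \<in> polys_below K x 1"
  using base_ring_carrier by (auto simp: polys_below_Suc polys_below_0 intro!: exI[of _ a])

lemma monic_values_carrier: "y \<in> monic_values K x d \<Longrightarrow> y \<in> carrier R"
  using polys_below_carrier x by (auto simp: monic_values_def)

lemma monic_values_mult:
  assumes "y \<in> monic_values K x d" "z \<in> monic_values K x e"
  shows "y \<otimes> z \<in> monic_values K x (d + e)"
proof -
  obtain y' z' where *: "y' \<in> polys_below K x d" "y = x [^] d \<oplus> y'"
    "z' \<in> polys_below K x e" "z = x [^] e \<oplus> z'"
    using assms by (auto simp: monic_values_def)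
  then have c: "y' \<in> carrier R" "z' \<in> carrier R" "x [^] d \<in> carrier R" "x [^] e \<in> carrier R"
    using polys_below_carrier x by auto
  have "x [^] (d + e) = x [^] d \<otimes> x [^] e" using x by (simp add: nat_pow_mult)
  then have "y \<otimes> z = x [^] (d + e) \<oplus> (x [^] d \<otimes> z' \<oplus> x [^] e \<otimes> y' \<oplus> y' \<otimes> z')"
    unfolding * using c by algebra
  moreover have "x [^] d \<otimes> z' \<oplus> x [^] e \<otimes> y' \<oplus> y' \<otimes> z' \<in> polys_below K x (d + e)"
    using polys_below_add polys_below_shift[of z' e d] polys_below_shift[of y' d e]
      polys_below_mult[of y' d z' e] * by (simp add: add.commute)
  ultimately show ?thesis by (auto simp: monic_values_def)
qed

lemma monic_values_diff:
  assumes "y \<in> monic_values K x d" "z \<in> polys_below K x d"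
  shows "y \<ominus> z \<in> monic_values K x d"
proof -
  obtain y' where *: "y' \<in> polys_below K x d" "y = x [^] d \<oplus> y'"
    using assms by (auto simp: monic_values_def)
  then have c: "y' \<in> carrier R" "z \<in> carrier R" "x [^] d \<in> carrier R"
    using polys_below_carrier x assms by auto
  have "y \<ominus> z = x [^] d \<oplus> (y' \<oplus> \<ominus> z)" unfolding * using c by algebra
  then show ?thesis using polys_below_add polys_below_minus * assms
    by (auto simp: monic_values_def)
qed

lemma monic_mult_below:
  assumes "y \<in> monic_values K x d" "z \<in> polys_below K x e"
  shows "y \<otimes> z \<in> polys_below K x (d + e)"
proof -
  obtain y' where *: "y' \<in> polys_below K x d" "y = x [^] d \<oplus> y'"
    using assms by (auto simp: monic_values_def)
  then have c: "y' \<in> carrier R" "z \<in> carrier R" "x [^] d \<in> carrier R"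
    using polys_below_carrier x assms by auto
  have "y \<otimes> z = x [^] d \<otimes> z \<oplus> y' \<otimes> z" unfolding * using c by algebra
  then show ?thesis using polys_below_add polys_below_shift polys_below_mult * assms by auto
qed

text \<open>A form of Cramer's rule that needs no determinants and no division. Every coefficient on the
  diagonal is monic of degree \<open>d\<close> and all others have degree below \<open>d\<close>. Eliminating one unknown by
  cross-multiplication with the pivot turns the diagonal coefficients into a product of two monic
  ones minus a term of degree below \<open>2d\<close>, and leaves the others of degree below \<open>2d\<close>. So the shape of
  the system persists with \<open>2d\<close> in place of \<open>d\<close>, and the last coefficient that remains is monic.\<close>

lemma elimination:
  assumes "finite J" "i0 \<notin> J" "m \<in> insert i0 J \<rightarrow> carrier R"
    and "\<And>i. i \<in> insert i0 J \<Longrightarrow> c i i \<in> monic_values K x d"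
    and "\<And>i j. i \<in> insert i0 J \<Longrightarrow> j \<in> insert i0 J \<Longrightarrow> i \<noteq> j \<Longrightarrow> c i j \<in> polys_below K x d"
    and "\<And>i. i \<in> insert i0 J \<Longrightarrow> (\<Oplus>j\<in>insert i0 J. c i j \<otimes> m j) = \<zero>"
  shows "\<exists>e. \<exists>q\<in>monic_values K x e. q \<otimes> m i0 = \<zero>"
  using assms
proof (induction J arbitrary: c d rule: finite_induct)
  case empty
  have "c i0 i0 \<in> carrier R" "m i0 \<in> carrier R"
    using empty monic_values_carrier by auto
  then show ?case using empty.prems(3)[of i0] empty.prems(5)[of i0] by auto
next
  case (insert n F)
  let ?I = "insert i0 F"
  have fI: "finite ?I" "n \<notin> ?I" using insert by auto
  have ins: "insert i0 (insert n F) = insert n ?I" by auto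
  note prems = insert.prems[unfolded ins]
  have cc: "c i j \<in> carrier R" if "i \<in> insert n ?I" "j \<in> insert n ?I" for i j
    using prems(3)[of i] prems(4)[of i j] that monic_values_carrier polys_below_carrier
    by (cases "i = j") auto
  have mc: "m j \<in> carrier R" if "j \<in> insert n ?I" for j using prems(2) that by auto
  \<comment> \<open>Row \<open>i\<close> is multiplied by the monic pivot and row \<open>n\<close> by \<open>c i n\<close>.\<close>
  define c' where "c' i j = c n n \<otimes> c i j \<ominus> c i n \<otimes> c n j" for i j
  have row: "c i n \<otimes> m n \<oplus> (\<Oplus>j\<in>?I. c i j \<otimes> m j) = \<zero>" if "i \<in> insert n ?I" for i
  proof -
    have "(\<Oplus>j\<in>insert n ?I. c i j \<otimes> m j) = c i n \<otimes> m n \<oplus> (\<Oplus>j\<in>?I. c i j \<otimes> m j)"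
      using fI cc mc that by (intro finsum_insert) auto
    then show ?thesis using prems(5)[OF that] by simp
  qed
  have "\<exists>e. \<exists>q\<in>monic_values K x e. q \<otimes> m i0 = \<zero>"
  proof (rule insert.IH[of c' "d + d"])
    show "i0 \<notin> F" using prems(1) by auto
    show "m \<in> ?I \<rightarrow> carrier R" using mc by auto
    show "c' i i \<in> monic_values K x (d + d)" if "i \<in> ?I" for i
      unfolding c'_def using that prems(3)[of n] prems(3)[of i] prems(4)[of i n] prems(4)[of n i] fI
      by (intro monic_values_diff monic_values_mult polys_below_mult) auto
    show "c' i j \<in> polys_below K x (d + d)" if "i \<in> ?I" "j \<in> ?I" "i \<noteq> j" for i j
    proof -
      have "i \<noteq> n" "n \<noteq> j" using that fI by auto
      then show ?thesis
        unfolding c'_def minus_eq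
        using that prems(3)[of n] prems(4)[of i j] prems(4)[of i n] prems(4)[of n j]
        by (intro polys_below_add polys_below_minus polys_below_mult monic_mult_below) auto
    qed
    show "(\<Oplus>j\<in>?I. c' i j \<otimes> m j) = \<zero>" if i: "i \<in> ?I" for i
    proof -
      define A B where "A = (\<Oplus>j\<in>?I. c i j \<otimes> m j)" and "B = (\<Oplus>j\<in>?I. c n j \<otimes> m j)"
      have car: "A \<in> carrier R" "B \<in> carrier R" "c n n \<in> carrier R" "c i n \<in> carrier R" "m n \<in> carrier R"
        unfolding A_def B_def using cc mc i by (auto intro!: finsum_closed)
      have "(\<Oplus>j\<in>?I. c' i j \<otimes> m j)
          = (\<Oplus>j\<in>?I. c n n \<otimes> (c i j \<otimes> m j) \<oplus> (\<ominus> c i n) \<otimes> (c n j \<otimes> m j))"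
      proof (rule finsum_cong')
        fix j assume j: "j \<in> ?I"
        have "c n n \<in> carrier R" "c i j \<in> carrier R" "c i n \<in> carrier R" "c n j \<in> carrier R" "m j \<in> carrier R"
          using cc mc i j by auto
        then show "c' i j \<otimes> m j = c n n \<otimes> (c i j \<otimes> m j) \<oplus> (\<ominus> c i n) \<otimes> (c n j \<otimes> m j)"
          unfolding c'_def by algebra
      qed (use cc mc i in auto)
      also have "\<dots> = (\<Oplus>j\<in>?I. c n n \<otimes> (c i j \<otimes> m j)) \<oplus> (\<Oplus>j\<in>?I. (\<ominus> c i n) \<otimes> (c n j \<otimes> m j))"
        using cc mc i by (intro finsum_addf) auto
      also have "\<dots> = c n n \<otimes> A \<oplus> (\<ominus> c i n) \<otimes> B"
        unfolding A_def B_def using cc mc i fI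
        by (subst (1 2) finsum_rdistr) auto
      also have "\<dots> = c n n \<otimes> (c i n \<otimes> m n \<oplus> A) \<ominus> c i n \<otimes> (c n n \<otimes> m n \<oplus> B)"
        using car by algebra
      also have "\<dots> = \<zero>"
        using row[of i] row[of n] i car unfolding A_def[symmetric] B_def[symmetric]
        by (simp add: minus_eq)
      finally show ?thesis .
    qed
  qed
  then show ?case .
qed

lemma lin_span_carrier:
  assumes "G \<subseteq> carrier R" shows "y \<in> lin_span K G \<Longrightarrow> y \<in> carrier R"
  by (induction rule: lin_span.induct) (use assms base_ring_carrier in auto)

lemma lin_span_add:
  assumes "G \<subseteq> carrier R" "z \<in> lin_span K G"
  shows "y \<in> lin_span K G \<Longrightarrow> y \<oplus> z \<in> lin_span K G"
proof (induction rule: lin_span.induct)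
  case zero then show ?case using assms lin_span_carrier by auto
next
  case (step a g y)
  then have "a \<in> carrier R" "g \<in> carrier R" "y \<in> carrier R" "z \<in> carrier R"
    using assms base_ring_carrier lin_span_carrier by auto
  then have "a \<otimes> g \<oplus> y \<oplus> z = a \<otimes> g \<oplus> (y \<oplus> z)" by algebra
  then show ?case using step lin_span.step by auto
qed

lemma lin_span_smult:
  assumes "G \<subseteq> carrier R" "k \<in> K"
  shows "y \<in> lin_span K G \<Longrightarrow> k \<otimes> y \<in> lin_span K G"
proof (induction rule: lin_span.induct)
  case zero then show ?case using assms base_ring_carrier lin_span.zero by auto
next
  case (step a g y)
  then have "a \<in> carrier R" "g \<in> carrier R" "y \<in> carrier R" "k \<in> carrier R"
    using assms base_ring_carrier lin_span_carrier by auto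
  then have "k \<otimes> (a \<otimes> g \<oplus> y) = (k \<otimes> a) \<otimes> g \<oplus> k \<otimes> y" by algebra
  then show ?case using step lin_span.step base_ring_rules(6) assms by auto
qed

lemma lin_span_minus:
  assumes "G \<subseteq> carrier R" "y \<in> lin_span K G" shows "\<ominus> y \<in> lin_span K G"
proof -
  have "\<ominus> \<one> \<otimes> y = \<ominus> y" using lin_span_carrier[OF assms] by algebra
  then show ?thesis using lin_span_smult[OF assms(1) _ assms(2), of "\<ominus> \<one>"] base_ring_rules(3,5) by auto
qed

lemma lin_span_gen:
  assumes "G \<subseteq> carrier R" "g \<in> G" shows "g \<in> lin_span K G"
  using lin_span.step[OF base_ring_rules(3) assms(2) lin_span.zero] assms by auto

text \<open>Multiplication by \<open>h\<close> is linear, so only the generators have to be checked.\<close>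

lemma lin_span_mult_right:
  assumes "G \<subseteq> carrier R" "H \<subseteq> carrier R" "h \<in> carrier R" "\<And>g. g \<in> G \<Longrightarrow> g \<otimes> h \<in> lin_span K H"
  shows "y \<in> lin_span K G \<Longrightarrow> y \<otimes> h \<in> lin_span K H"
proof (induction rule: lin_span.induct)
  case zero then show ?case using assms lin_span.zero by auto
next
  case (step a g y)
  then have "a \<in> carrier R" "g \<in> carrier R" "y \<in> carrier R"
    using assms base_ring_carrier lin_span_carrier by auto
  then have "(a \<otimes> g \<oplus> y) \<otimes> h = a \<otimes> (g \<otimes> h) \<oplus> y \<otimes> h" using assms by algebra
  then show ?case using step lin_span_add lin_span_smult assms by auto
qed

lemma lin_span_finsum:
  assumes "G \<subseteq> carrier R" "finite G"
  shows "y \<in> lin_span K G \<Longrightarrow> \<exists>a\<in>G \<rightarrow> K. y = (\<Oplus>g\<in>G. a g \<otimes> g)"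
proof (induction rule: lin_span.induct)
  case zero
  have "(\<Oplus>g\<in>G. \<zero> \<otimes> g) = \<zero>"
    using finsum_cong'[of G G "\<lambda>_. \<zero>" "\<lambda>g. \<zero> \<otimes> g"] assms by (auto simp: subset_iff)
  then show ?case using base_ring_rules(2) by (intro bexI[of _ "\<lambda>_. \<zero>"]) auto
next
  case (step k g y)
  then obtain a where a: "a \<in> G \<rightarrow> K" "y = (\<Oplus>g\<in>G. a g \<otimes> g)" by auto
  define b where "b h = (if h = g then k \<oplus> a h else a h)" for h
  have b: "b \<in> G \<rightarrow> K" using a(1) step.hyps base_ring_rules(7) by (auto simp: b_def Pi_iff)
  have car: "a h \<in> carrier R" "b h \<in> carrier R" "h \<in> carrier R" if "h \<in> G" for h
    using that a b assms base_ring_carrier by auto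
  have kc: "k \<in> carrier R" using step base_ring_carrier by auto
  have "(\<Oplus>h\<in>G. b h \<otimes> h) = (\<Oplus>h\<in>G. (if g = h then k \<otimes> h else \<zero>) \<oplus> a h \<otimes> h)"
    by (rule finsum_cong') (use car kc in \<open>auto simp: b_def l_distr\<close>)
  also have "\<dots> = (\<Oplus>h\<in>G. (if g = h then k \<otimes> h else \<zero>)) \<oplus> (\<Oplus>h\<in>G. a h \<otimes> h)"
    by (rule finsum_addf) (use car kc in auto)
  also have "(\<Oplus>h\<in>G. (if g = h then k \<otimes> h else \<zero>)) = k \<otimes> g"
    by (rule finsum_singleton) (use step assms kc in auto)
  finally show ?case using a b by (intro bexI[of _ b]) auto
qed

end

end

text \<open>Writing \<open>x g = \<Sum>\<^sub>h a\<^sub>g\<^sub>h h\<close> for \<open>g \<in> G\<close> gives a homogeneous linear system satisfied by the elements of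
  \<open>G\<close>, with monic linear diagonal entries \<open>x - a\<^sub>g\<^sub>g\<close> and constants elsewhere. Elimination yields a
  monic polynomial in \<open>x\<close> that annihilates \<open>g\<^sub>0 \<noteq> 0\<close>, and therefore vanishes.\<close>

lemma (in domain) integral_over_if_stable:
  assumes K: "subring K R" and x: "x \<in> carrier R" and G: "finite G" "G \<subseteq> carrier R" "g0 \<in> G" "g0 \<noteq> \<zero>"
    and stable: "\<And>g. g \<in> G \<Longrightarrow> x \<otimes> g \<in> lin_span K G"
  shows "integral_over R K x"
proof -
  note Kr = subringE[OF K]
  have "\<exists>a\<in>G \<rightarrow> K. \<ominus> (x \<otimes> g) = (\<Oplus>h\<in>G. a h \<otimes> h)" if "g \<in> G" for g
    using lin_span_finsum[OF K x G(2,1) lin_span_minus[OF K x G(2) stable[OF that]]] .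
  then obtain a where a: "\<And>g. g \<in> G \<Longrightarrow> a g \<in> G \<rightarrow> K"
      "\<And>g. g \<in> G \<Longrightarrow> \<ominus> (x \<otimes> g) = (\<Oplus>h\<in>G. a g h \<otimes> h)"
    by metis
  have aK: "a g h \<in> K" "a g h \<in> carrier R" if "g \<in> G" "h \<in> G" for g h
    using a(1)[OF that(1)] that Kr(1) by auto
  define c where "c g h = (if g = h then x else \<zero>) \<oplus> a g h" for g h
  have ins: "insert g0 (G - {g0}) = G" using G by auto
  have "\<exists>e. \<exists>q\<in>monic_values K x e. q \<otimes> g0 = \<zero>"
  proof (rule elimination[OF K x, where J = "G - {g0}" and m = "\<lambda>h. h" and c = c and d = 1], unfold ins)
    show "c g g \<in> monic_values K x 1" if "g \<in> G" for g
      using const_polys_below[OF K x aK(1)[OF that that]] x by (auto simp: c_def monic_values_def)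
    show "c g h \<in> polys_below K x 1" if "g \<in> G" "h \<in> G" "g \<noteq> h" for g h
      using const_polys_below[OF K x aK(1)[OF that(1,2)]] aK[OF that(1,2)] that by (auto simp: c_def)
    show "(\<Oplus>h\<in>G. c g h \<otimes> h) = \<zero>" if g: "g \<in> G" for g
    proof -
      have car: "h \<in> carrier R" "a g h \<in> carrier R" if "h \<in> G" for h
        using that g aK G by auto
      have "(\<Oplus>h\<in>G. c g h \<otimes> h) = (\<Oplus>h\<in>G. (if g = h then x \<otimes> h else \<zero>) \<oplus> a g h \<otimes> h)"
        by (rule finsum_cong') (use car x in \<open>auto simp: c_def l_distr\<close>)
      also have "\<dots> = (\<Oplus>h\<in>G. (if g = h then x \<otimes> h else \<zero>)) \<oplus> (\<Oplus>h\<in>G. a g h \<otimes> h)"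
        by (rule finsum_addf) (use car x in auto)
      also have "(\<Oplus>h\<in>G. (if g = h then x \<otimes> h else \<zero>)) = x \<otimes> g"
        by (rule finsum_singleton) (use g G x in auto)
      also have "(\<Oplus>h\<in>G. a g h \<otimes> h) = \<ominus> (x \<otimes> g)"
        using a(2)[OF g] by simp
      finally show ?thesis using car[OF g] x by (simp add: r_neg)
    qed
  qed (use G in auto)
  then obtain e q where q: "q \<in> monic_values K x e" "q \<otimes> g0 = \<zero>" by auto
  then have "q = \<zero>"
    using G monic_values_carrier[OF K x] integral_iff by blast
  then obtain p where p: "set p \<subseteq> K" "length p = e" "x [^] e \<oplus> eval p x = \<zero>"
    using q by (auto simp: monic_values_def polys_below_def)
  have "polynomial K (\<one> # p)" using p Kr(3) by (auto simp: polynomial_def)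
  moreover have "eval (\<one> # p) x = \<zero>" using p x by simp
  ultimately show ?thesis
    unfolding integral_over_def univ_poly_carrier[symmetric] by (intro bexI[of _ "\<one> # p"]) (auto simp: univ_poly_carrier[symmetric])
qed

text \<open>If \<open>x\<close> is a root of a monic polynomial of degree \<open>n\<close>, then \<open>1, x, \<dots>, x\<^bsup>n-1\<^esup>\<close> is such a set; \<open>n\<close> is
  positive because \<open>1 \<noteq> 0\<close>.\<close>

lemma (in domain) stable_if_integral_over:
  assumes K: "subring K R" and x: "x \<in> carrier R" and int: "integral_over R K x"
  shows "\<exists>G. finite G \<and> G \<subseteq> carrier R \<and> \<one> \<in> G \<and> (\<forall>g\<in>G. x \<otimes> g \<in> lin_span K G)"
proof -
  obtain q where q: "polynomial K q" "q \<noteq> []" "hd q = \<one>" "eval q x = \<zero>"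
    using int univ_poly_carrier[of R K] unfolding integral_over_def by blast
  then obtain p where qp: "q = \<one> # p" by (cases q) auto
  have p: "set p \<subseteq> K" using q qp by (auto simp: polynomial_def)
  define n where "n = length p"
  have ep: "x [^] n \<oplus> eval p x = \<zero>" using q x by (simp add: qp n_def)
  have epc: "eval p x \<in> carrier R" using eval_in_carrier[OF _ x] p subringE(1)[OF K] by auto
  define G where "G = (\<lambda>i. x [^] i) ` {..<n}"
  have G: "G \<subseteq> carrier R" using x by (auto simp: G_def)
  have "eval r x \<in> lin_span K G" if "set r \<subseteq> K" "length r \<le> n" for r
    using that
  proof (induction r)
    case Nil then show ?case by (simp add: lin_span.zero)
  next
    case (Cons a r)
    then show ?case by (auto intro!: lin_span.step simp: G_def)
  qed
  then have "\<ominus> eval p x \<in> lin_span K G"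
    using lin_span_minus[OF K x G] p by (simp add: n_def)
  moreover have "x [^] n = \<ominus> eval p x"
    using ep epc x by (simp add: minus_equality)
  ultimately have top: "x [^] n \<in> lin_span K G" by simp
  have "n \<noteq> 0" using ep by (auto simp: n_def)
  moreover have "x \<otimes> g \<in> lin_span K G" if "g \<in> G" for g
  proof -
    obtain i where i: "i < n" "g = x [^] i" using \<open>g \<in> G\<close> by (auto simp: G_def)
    then have "x \<otimes> g = x [^] (Suc i)" using x by (simp add: m_comm)
    moreover have "Suc i = n \<or> Suc i < n" using i by auto
    moreover have "x [^] Suc i \<in> G" if "Suc i < n"
      unfolding G_def using that by blast
    ultimately show ?thesis using top lin_span_gen[OF K x G, of "x [^] Suc i"] by metis
  qed
  ultimately show ?thesis using G unfolding G_def
    by (intro exI[of _ "(\<lambda>i. x [^] i) ` {..<n}"]) (auto simp: image_iff intro!: bexI[of _ 0])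
qed

text \<open>If \<open>G\<close> is stable under \<open>x\<close> and \<open>H\<close> under \<open>y\<close>, the set of all products \<open>g h\<close> is stable under both, hence
  under the sum and the product of \<open>x\<close> and \<open>y\<close>.\<close>

lemma (in domain) integral_over_add_mult:
  assumes K: "subring K R" and x: "x \<in> carrier R" "integral_over R K x"
    and y: "y \<in> carrier R" "integral_over R K y"
  shows "integral_over R K (x \<oplus> y)" "integral_over R K (x \<otimes> y)"
proof -
  obtain G where G: "finite G" "G \<subseteq> carrier R" "\<one> \<in> G" "\<And>g. g \<in> G \<Longrightarrow> x \<otimes> g \<in> lin_span K G"
    using stable_if_integral_over[OF K x] by auto
  obtain H where H: "finite H" "H \<subseteq> carrier R" "\<one> \<in> H" "\<And>g. g \<in> H \<Longrightarrow> y \<otimes> g \<in> lin_span K H"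
    using stable_if_integral_over[OF K y] by auto
  define M where "M = (\<lambda>(g, h). g \<otimes> h) ` (G \<times> H)"
  have fM: "finite M" using G H by (simp add: M_def)
  have M: "M \<subseteq> carrier R" using G H by (auto simp: M_def)
  have oM: "\<one> \<in> M" using G H unfolding M_def by (intro image_eqI[of _ _ "(\<one>, \<one>)"]) auto
  have gh: "g \<otimes> h \<in> lin_span K M" if "g \<in> G" "h \<in> H" for g h
    using lin_span_gen[OF K x(1) M] that by (auto simp: M_def)
  have xM: "x \<otimes> m \<in> lin_span K M" and yM: "y \<otimes> m \<in> lin_span K M" if "m \<in> M" for m
  proof -
    obtain g h where m: "g \<in> G" "h \<in> H" "m = g \<otimes> h" using \<open>m \<in> M\<close> by (auto simp: M_def)
    have c: "g \<in> carrier R" "h \<in> carrier R" using m G H by auto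
    have "(x \<otimes> g) \<otimes> h \<in> lin_span K M"
      by (rule lin_span_mult_right[OF K x(1) G(2) M c(2) gh G(4)]) (use m in auto)
    then show "x \<otimes> m \<in> lin_span K M" using m c x by (simp add: m_assoc)
    have "(y \<otimes> h) \<otimes> g \<in> lin_span K M"
    proof (rule lin_span_mult_right[OF K x(1) H(2) M c(1) _ H(4)[OF m(2)]])
      show "h' \<otimes> g \<in> lin_span K M" if "h' \<in> H" for h'
        using gh[OF m(1) that] m_comm[of h' g] c H(2) that by auto
    qed
    moreover have "y \<otimes> m = (y \<otimes> h) \<otimes> g" unfolding m using c y by algebra
    ultimately show "y \<otimes> m \<in> lin_span K M" by simp
  qed
  show "integral_over R K (x \<oplus> y)"
  proof (rule integral_over_if_stable[OF K _ fM M oM])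
    fix m assume m: "m \<in> M"
    then have "(x \<oplus> y) \<otimes> m = x \<otimes> m \<oplus> y \<otimes> m" using M x y by (auto simp: l_distr)
    then show "(x \<oplus> y) \<otimes> m \<in> lin_span K M"
      using lin_span_add[OF K x(1) M] xM[OF m] yM[OF m] by simp
  qed (use x y in auto)
  show "integral_over R K (x \<otimes> y)"
  proof (rule integral_over_if_stable[OF K _ fM M oM])
    fix m assume m: "m \<in> M"
    then have "(x \<otimes> y) \<otimes> m = (y \<otimes> m) \<otimes> x" using M x y by (auto simp: m_ac subset_iff)
    moreover have "(y \<otimes> m) \<otimes> x \<in> lin_span K M"
    proof (rule lin_span_mult_right[OF K x(1) M M x(1) _ yM[OF m]])
      show "m' \<otimes> x \<in> lin_span K M" if "m' \<in> M" for m'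
        using xM[OF that] m_comm[of m' x] x M that by auto
    qed
    ultimately show "(x \<otimes> y) \<otimes> m \<in> lin_span K M" by simp
  qed (use x y in auto)
qed

lemma (in domain) integral_over_subring:
  assumes K: "subring K R" and a: "a \<in> K"
  shows "integral_over R K a"
proof (rule integral_over_if_stable[OF K, of _ "{\<one>}" \<one>])
  show "a \<in> carrier R" using subringE(1)[OF K] a by auto
  have "a \<otimes> \<one> \<oplus> \<zero> \<in> lin_span K {\<one>}"
    by (rule lin_span.step[OF a _ lin_span.zero]) simp
  with \<open>a \<in> carrier R\<close> have "a \<otimes> \<one> \<in> lin_span K {\<one>}" by simp
  then show "a \<otimes> g \<in> lin_span K {\<one>}" if "g \<in> {\<one>}" for g using that by auto
qed auto

section \<open>Extending homomorphisms to an algebraically closed field\<close>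

lemma RDirProd_simps:
  "carrier (RDirProd R S) = carrier R \<times> carrier S"
  "x \<otimes>\<^bsub>RDirProd R S\<^esub> y = (fst x \<otimes>\<^bsub>R\<^esub> fst y, snd x \<otimes>\<^bsub>S\<^esub> snd y)"
  "x \<oplus>\<^bsub>RDirProd R S\<^esub> y = (fst x \<oplus>\<^bsub>R\<^esub> fst y, snd x \<oplus>\<^bsub>S\<^esub> snd y)"
  "\<one>\<^bsub>RDirProd R S\<^esub> = (\<one>\<^bsub>R\<^esub>, \<one>\<^bsub>S\<^esub>)" "\<zero>\<^bsub>RDirProd R S\<^esub> = (\<zero>\<^bsub>R\<^esub>, \<zero>\<^bsub>S\<^esub>)"
  by (auto simp: RDirProd_def DirProd_def monoid.defs split: prod.splits)

lemma RDirProd_cring: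
  assumes "cring R" "cring S" shows "cring (RDirProd R S)"
proof -
  interpret R: cring R by fact
  interpret S: cring S by fact
  interpret ring "RDirProd R S" by (rule RDirProd_ring) unfold_locales
  show ?thesis
    by unfold_locales (auto simp: RDirProd_simps R.m_comm S.m_comm)
qed

lemma RDirProd_fst_hom: "ring R \<Longrightarrow> ring S \<Longrightarrow> ring_hom_ring (RDirProd R S) R fst"
  by (rule ring_hom_ringI) (auto simp: RDirProd_ring RDirProd_simps)

lemma RDirProd_snd_hom: "ring R \<Longrightarrow> ring S \<Longrightarrow> ring_hom_ring (RDirProd R S) S snd"
  by (rule ring_hom_ringI) (auto simp: RDirProd_ring RDirProd_simps)

context cring
begin

text \<open>These two lemmas are applied to the product of two domains, which has zero divisors.\<close>

lemma simple_extension_add: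
  assumes K: "subring K R" and x: "x \<in> carrier R"
    and "u \<in> simple_extension K x" "v \<in> simple_extension K x"
  shows "u \<oplus> v \<in> simple_extension K x"
proof -
  have car: "w \<in> carrier R" if "w \<in> simple_extension K x" for w
    using simple_extension_in_carrier[OF subringE(1)[OF K] x] that by auto
  show ?thesis using assms(3,4)
  proof (induction arbitrary: v rule: simple_extension.induct)
    case zero then show ?case using car by simp
  next
    case (lin k1 k2)
    from lin.prems show ?case
    proof cases
      case zero
      have "k1 \<otimes> x \<oplus> k2 \<in> simple_extension K x" using lin by (auto intro: simple_extension.lin)
      then show ?thesis using zero car by auto
    next
      case (lin l1 l2)
      have c: "k1 \<in> carrier R" "l1 \<in> carrier R" "k2 \<in> carrier R" "l2 \<in> carrier R"
        using lin \<open>k1 \<in> _\<close> \<open>k2 \<in> K\<close> car subringE(1)[OF K] by auto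
      have "k1 \<otimes> x \<oplus> k2 \<oplus> v = (k1 \<oplus> l1) \<otimes> x \<oplus> (k2 \<oplus> l2)"
        unfolding lin using c x by algebra
      then show ?thesis
        using lin \<open>k2 \<in> K\<close> lin.IH[of l1] subringE(7)[OF K] by (auto intro!: simple_extension.lin)
    qed
  qed
qed

lemma simple_extension_subring:
  assumes K: "subring K R" and x: "x \<in> carrier R"
  shows "subring (simple_extension K x) R"
proof -
  note Kr = subringE[OF K]
  have car: "w \<in> carrier R" if "w \<in> simple_extension K x" for w
    using simple_extension_in_carrier[OF Kr(1) x] that by auto
  have sc: "k \<otimes> v \<in> simple_extension K x" if "k \<in> K" "v \<in> simple_extension K x" for k v
    using that(2)
  proof (induction rule: simple_extension.induct)
    case zero then show ?case using that Kr(1) by auto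
  next
    case (lin k1 k2)
    have "k \<in> carrier R" "k1 \<in> carrier R" "k2 \<in> carrier R" using that lin car Kr(1) by auto
    then have "k \<otimes> (k1 \<otimes> x \<oplus> k2) = (k \<otimes> k1) \<otimes> x \<oplus> k \<otimes> k2" using x by algebra
    then show ?case using lin that Kr(6) by (auto intro!: simple_extension.lin)
  qed
  have K_in: "k \<in> simple_extension K x" if "k \<in> K" for k
    using simple_extension_incl[OF Kr(1) x] that by auto
  have mult: "u \<otimes> v \<in> simple_extension K x" if "u \<in> simple_extension K x" "v \<in> simple_extension K x" for u v
    using that(1)
  proof (induction rule: simple_extension.induct)
    case zero then show ?case using that car by auto
  next
    case (lin k1 k2)
    have c: "v \<in> carrier R" "k1 \<in> carrier R" "k2 \<in> carrier R" using that lin car Kr(1) by auto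
    then have "(k1 \<otimes> x \<oplus> k2) \<otimes> v = ((k1 \<otimes> v) \<otimes> x \<oplus> \<zero>) \<oplus> k2 \<otimes> v" using x by algebra
    moreover have "(k1 \<otimes> v) \<otimes> x \<oplus> \<zero> \<in> simple_extension K x"
      by (rule simple_extension.lin) (use lin Kr(2) in auto)
    ultimately show ?case using simple_extension_add[OF K x] sc lin that by auto
  qed
  show ?thesis
  proof (rule subringI)
    show "\<ominus> v \<in> simple_extension K x" if "v \<in> simple_extension K x" for v
    proof -
      have "\<ominus> v = \<ominus> \<one> \<otimes> v" using car[OF that] by algebra
      then show ?thesis using sc[OF _ that] Kr(3,5) by auto
    qed
  qed (use car mult simple_extension_add[OF K x] K_in[OF Kr(3)] in auto)
qed

lemma eval_replicate_zero:
  assumes "x \<in> carrier R" shows "eval (replicate k \<zero>) x = \<zero>"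
  using assms by (induction k) auto

lemma eval_map2_combination:
  assumes "length p = length q" "set p \<subseteq> carrier R" "set q \<subseteq> carrier R" "a \<in> carrier R" "b \<in> carrier R"
    "x \<in> carrier R"
  shows "eval (map2 (\<lambda>u v. b \<otimes> u \<ominus> a \<otimes> v) p q) x = b \<otimes> eval p x \<ominus> a \<otimes> eval q x"
  using assms(1-3)
proof (induction p q rule: list_induct2)
  case Nil then show ?case using assms by (simp add: minus_eq)
next
  case (Cons u p v q)
  have c: "eval p x \<in> carrier R" "eval q x \<in> carrier R" "u \<in> carrier R" "v \<in> carrier R"
    "x [^] length q \<in> carrier R"
    using Cons assms eval_in_carrier by auto
  have "eval (map2 (\<lambda>u v. b \<otimes> u \<ominus> a \<otimes> v) (u # p) (v # q)) x
      = (b \<otimes> u \<ominus> a \<otimes> v) \<otimes> x [^] length q \<oplus> (b \<otimes> eval p x \<ominus> a \<otimes> eval q x)"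
    using Cons by simp
  also have "\<dots> = b \<otimes> (u \<otimes> x [^] length q \<oplus> eval p x) \<ominus> a \<otimes> (v \<otimes> x [^] length q \<oplus> eval q x)"
    using c assms by algebra
  finally show ?case using Cons by simp
qed

text \<open>One step of pseudo-division: \<open>b (a x\<^sup>n + \<dots>)\<close> minus a multiple of the relation \<open>b x\<^sup>m + \<dots> = 0\<close> has no
  term of degree \<open>n\<close> any more.\<close>

lemma pseudo_division_step:
  assumes K: "subring K R" and x: "x \<in> carrier R"
    and q: "set (b # q) \<subseteq> K" "eval (b # q) x = \<zero>" and h: "set (a # h) \<subseteq> K" and len: "length q \<le> length h"
  shows "\<exists>r. set r \<subseteq> K \<and> length r = length h \<and> eval r x = b \<otimes> eval (a # h) x"
proof -
  note Kr = subringE[OF K]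
  define k where "k = length h - length q"
  define q' where "q' = q @ replicate k \<zero>"
  define r where "r = map2 (\<lambda>u v. b \<otimes> u \<ominus> a \<otimes> v) h q'"
  have lq: "length h = length q'" using len by (simp add: q'_def k_def)
  have sq: "set q' \<subseteq> K" using q Kr(2) by (auto simp: q'_def)
  have c: "a \<in> carrier R" "b \<in> carrier R" "eval h x \<in> carrier R" "eval q x \<in> carrier R"
    "x [^] k \<in> carrier R" "x [^] length q \<in> carrier R" "x [^] length h \<in> carrier R"
    using q h x Kr(1) by (auto intro!: eval_in_carrier)
  have "set r \<subseteq> K"
  proof
    fix w assume "w \<in> set r"
    then obtain u v where "u \<in> set h" "v \<in> set q'" "w = b \<otimes> u \<ominus> a \<otimes> v"
      unfolding r_def by (auto dest: set_zip_leftD set_zip_rightD)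
    then show "w \<in> K" unfolding minus_eq using q h sq Kr(5-7) by (auto simp: subset_iff)
  qed
  moreover have "length r = length h" using lq by (simp add: r_def)
  moreover have "eval r x = b \<otimes> eval (a # h) x"
  proof -
    have ev: "eval q' x = eval q x \<otimes> x [^] k"
    proof -
      have "set q \<subseteq> carrier R" "set (replicate k \<zero>) \<subseteq> carrier R"
        using q Kr(1) by (auto simp: set_replicate_conv_if)
      then show ?thesis
        unfolding q'_def using eval_append[of q "replicate k \<zero>" x] x c
        by (simp add: eval_replicate_zero)
    qed
    have "eval r x = b \<otimes> eval h x \<ominus> a \<otimes> (eval q x \<otimes> x [^] k)"
      unfolding r_def ev[symmetric]
      using eval_map2_combination[OF lq, of a b x] h sq c x Kr(1) by auto
    moreover have "eval q x = \<ominus> (b \<otimes> x [^] length q)"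
      using q(2) c minus_equality[of "eval q x" "b \<otimes> x [^] length q"] by (simp add: a_comm)
    moreover have "x [^] length h = x [^] length q \<otimes> x [^] k"
      using x len by (simp add: nat_pow_mult k_def)
    ultimately show ?thesis using c by simp algebra
  qed
  ultimately show ?thesis by blast
qed

end

lemma (in algebraically_closed) ex_root:
  assumes "set p \<subseteq> carrier L" "p \<noteq> []" "hd p \<noteq> \<zero>" "length p \<ge> 2"
  shows "\<exists>t\<in>carrier L. eval p t = \<zero>"
proof -
  have p: "p \<in> carrier (poly_ring L)"
    using assms by (auto simp: univ_poly_carrier[symmetric] polynomial_def)
  have "size (roots p) = degree p" using roots_over_carrier[OF p] by (simp add: splitted_def)
  then have "roots p \<noteq> {#}" using assms by auto
  then obtain t where "t \<in># roots p" by auto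
  then show ?thesis using roots_mem_iff_is_root[OF p] by (auto simp: is_root_def)
qed

text \<open>A homomorphism from a subring of \<open>S\<close> to \<open>L\<close> is represented by its graph, a subring of \<open>S \<times> L\<close>; for a
  subring, single-valuedness need only be required at \<open>0\<close>. Extending the homomorphism by \<open>s \<mapsto> t\<close> then
  means adjoining the single element \<open>(s, t)\<close>.\<close>

definition partial_hom_graph :: "('b, 'y) ring_scheme \<Rightarrow> ('l, 'z) ring_scheme \<Rightarrow> ('b \<times> 'l) set \<Rightarrow> bool" where
  "partial_hom_graph S L \<Gamma> \<longleftrightarrow> subring \<Gamma> (RDirProd S L) \<and> (\<forall>l. (\<zero>\<^bsub>S\<^esub>, l) \<in> \<Gamma> \<longrightarrow> l = \<zero>\<^bsub>L\<^esub>)"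

text \<open>Among the nontrivial relations of \<open>s\<close> over the domain of the homomorphism, take one of least length,
  \<open>q\<close>, and let \<open>t\<close> be a root in \<open>L\<close> of its image, which is not constant because the homomorphism is
  injective. Pseudo-division by \<open>q\<close> shows that the image of every relation of \<open>s\<close> vanishes at \<open>t\<close>; this
  is what makes \<open>s \<mapsto> t\<close> well defined.\<close>

lemma partial_hom_graph_adjoin:
  assumes S: "domain S" and L: "algebraically_closed L" and \<Gamma>: "partial_hom_graph S L \<Gamma>"
    and inj: "\<And>b. (b, \<zero>\<^bsub>L\<^esub>) \<in> \<Gamma> \<Longrightarrow> b = \<zero>\<^bsub>S\<^esub>"
    and s: "s \<in> carrier S"
    and rel: "\<exists>p. set p \<subseteq> \<Gamma> \<and> p \<noteq> [] \<and> fst (hd p) \<noteq> \<zero>\<^bsub>S\<^esub> \<and> ring.eval S (map fst p) s = \<zero>\<^bsub>S\<^esub>"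
  shows "\<exists>\<Gamma>'. partial_hom_graph S L \<Gamma>' \<and> \<Gamma> \<subseteq> \<Gamma>' \<and> s \<in> fst ` \<Gamma>'"
proof -
  interpret S: domain S by fact
  interpret L: algebraically_closed L by fact
  interpret B: cring "RDirProd S L" by (rule RDirProd_cring) unfold_locales
  interpret p1: ring_hom_ring "RDirProd S L" S fst by (rule RDirProd_fst_hom) unfold_locales
  interpret p2: ring_hom_ring "RDirProd S L" L snd by (rule RDirProd_snd_hom) unfold_locales
  have sub: "subring \<Gamma> (RDirProd S L)" and graph: "\<And>l. (\<zero>\<^bsub>S\<^esub>, l) \<in> \<Gamma> \<Longrightarrow> l = \<zero>\<^bsub>L\<^esub>"
    using \<Gamma> by (auto simp: partial_hom_graph_def)
  have \<Gamma>c: "\<Gamma> \<subseteq> carrier S \<times> carrier L" using subringE(1)[OF sub] by (simp add: RDirProd_simps)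
  define rels where "rels p \<longleftrightarrow> set p \<subseteq> \<Gamma> \<and> p \<noteq> [] \<and> fst (hd p) \<noteq> \<zero>\<^bsub>S\<^esub> \<and>
    ring.eval S (map fst p) s = \<zero>\<^bsub>S\<^esub>" for p
  \<comment> \<open>Leading coefficients are compared in \<open>S\<close>, the first component.\<close>
  obtain q where q: "rels q" and q_min: "\<And>p. rels p \<Longrightarrow> length q \<le> length p"
    using rel ex_has_least_nat[of rels _ length] unfolding rels_def by metis
  then obtain b q' where bq: "q = b # q'" unfolding rels_def by (cases q) auto
  have b: "b \<in> \<Gamma>" "fst b \<noteq> \<zero>\<^bsub>S\<^esub>" using q by (auto simp: bq rels_def)
  then have snd_b: "snd b \<noteq> \<zero>\<^bsub>L\<^esub>" using inj[of "fst b"] by (metis prod.collapse)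
  have bc: "fst b \<in> carrier S" "snd b \<in> carrier L" using b \<Gamma>c by auto
  have "q' \<noteq> []" using q b bc s by (auto simp: bq rels_def)
  then have "length (map snd q) \<ge> 2" by (cases q') (auto simp: bq)
  then have "\<exists>t\<in>carrier L. L.eval (map snd q) t = \<zero>\<^bsub>L\<^esub>"
    using q snd_b \<Gamma>c by (intro L.ex_root) (auto simp: bq rels_def)
  then obtain t where t: "t \<in> carrier L" "L.eval (map snd q) t = \<zero>\<^bsub>L\<^esub>" by auto
  define Y where "Y = (s, t)"
  have Y: "Y \<in> carrier (RDirProd S L)" using s t by (simp add: Y_def RDirProd_simps)
  have ev: "B.eval h Y = (S.eval (map fst h) s, L.eval (map snd h) t)" if "set h \<subseteq> \<Gamma>" for h
    using p1.eval_hom'[OF Y, of h] p2.eval_hom'[OF Y, of h] subringE(1)[OF sub] that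
    by (auto simp: Y_def prod_eq_iff)
  have evq: "B.eval (b # q') Y = \<zero>\<^bsub>RDirProd S L\<^esub>"
    using ev[of q] q t by (simp add: bq rels_def RDirProd_simps)
  have main: "snd (B.eval h Y) = \<zero>\<^bsub>L\<^esub>" if "set h \<subseteq> \<Gamma>" "fst (B.eval h Y) = \<zero>\<^bsub>S\<^esub>" for h
    using that
  proof (induction h rule: length_induct)
    case (1 h)
    show ?case
    proof (cases h)
      case Nil then show ?thesis by (simp add: RDirProd_simps)
    next
      case (Cons a h')
      have h'c: "B.eval h' Y \<in> carrier (RDirProd S L)"
        using 1 Cons Y subringE(1)[OF sub] by (intro B.eval_in_carrier) auto
      show ?thesis
      proof (cases "fst a = \<zero>\<^bsub>S\<^esub>")
        case True
        then have "a = \<zero>\<^bsub>RDirProd S L\<^esub>"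
          using graph[of "snd a"] 1 Cons by (auto simp: RDirProd_simps prod_eq_iff) (metis prod.collapse)
        then have "B.eval h Y = B.eval h' Y" using Cons Y h'c by simp
        then show ?thesis using 1 Cons by auto
      next
        case False
        then have "rels h" using 1 Cons ev[of h] by (auto simp: rels_def)
        then have "length q' \<le> length h'" using q_min[of h] by (simp add: Cons bq)
        then obtain r where r: "set r \<subseteq> \<Gamma>" "length r = length h'"
            "B.eval r Y = b \<otimes>\<^bsub>RDirProd S L\<^esub> B.eval (a # h') Y"
          using B.pseudo_division_step[OF sub Y, of b q' a h'] evq q 1 Cons by (auto simp: bq rels_def)
        have "fst (B.eval r Y) = \<zero>\<^bsub>S\<^esub>"
          unfolding r(3) using 1 Cons bc by (simp add: RDirProd_simps)
        then have "snd (B.eval r Y) = \<zero>\<^bsub>L\<^esub>" using 1(1) r(1,2) Cons by (metis length_Cons lessI)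
        then have "snd b \<otimes>\<^bsub>L\<^esub> snd (B.eval h Y) = \<zero>\<^bsub>L\<^esub>"
          unfolding r(3) Cons by (simp add: RDirProd_simps)
        moreover have "snd (B.eval h Y) \<in> carrier L"
          using B.eval_in_carrier[OF _ Y, of h] 1 subringE(1)[OF sub] by (auto simp: RDirProd_simps)
        ultimately show ?thesis using snd_b bc L.integral_iff by blast
      qed
    qed
  qed
  let ?E = "B.simple_extension \<Gamma> Y"
  have "subring ?E (RDirProd S L)" by (rule B.simple_extension_subring[OF sub Y])
  moreover have "l = \<zero>\<^bsub>L\<^esub>" if "(\<zero>\<^bsub>S\<^esub>, l) \<in> ?E" for l
  proof -
    have "(\<zero>\<^bsub>S\<^esub>, l) \<in> (\<lambda>h. B.eval h Y) ` carrier (\<Gamma>[X]\<^bsub>RDirProd S L\<^esub>)"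
      using that unfolding B.simple_extension_as_eval_img[OF subringE(1)[OF sub] Y] .
    then obtain h where h: "(\<zero>\<^bsub>S\<^esub>, l) = B.eval h Y" "h \<in> carrier (\<Gamma>[X]\<^bsub>RDirProd S L\<^esub>)"
      by (rule imageE)
    have "set h \<subseteq> \<Gamma>"
      using h(2) unfolding univ_poly_carrier[symmetric] polynomial_def by auto
    then have "snd (\<zero>\<^bsub>S\<^esub>, l) = \<zero>\<^bsub>L\<^esub>" unfolding h(1) by (rule main) (simp flip: h(1))
    then show ?thesis by simp
  qed
  moreover have "\<Gamma> \<subseteq> ?E" using B.simple_extension_incl[OF subringE(1)[OF sub] Y] .
  moreover have "Y \<in> ?E" using B.simple_extension_mem[OF sub Y] .
  then have "s \<in> fst ` ?E" using image_eqI[of s fst Y] by (simp add: Y_def)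
  ultimately show ?thesis unfolding partial_hom_graph_def by blast
qed

text \<open>A nonzero element divides the nonzero constant term of an equation of integral dependence; hence
  a homomorphism that is injective on \<open>K\<close> cannot send it to \<open>0\<close>.\<close>

lemma (in domain) integral_nonzero_const_term:
  assumes K: "subring K R" and x: "x \<in> carrier R" "x \<noteq> \<zero>" and int: "integral_over R K x"
  shows "\<exists>p k. set p \<subseteq> K \<and> k \<in> K \<and> k \<noteq> \<zero> \<and> eval (p @ [k]) x = \<zero>"
proof -
  note Kr = subringE[OF K]
  define P where "P q \<longleftrightarrow> set q \<subseteq> K \<and> q \<noteq> [] \<and> hd q = \<one> \<and> eval q x = \<zero>" for q
  obtain q0 where "q0 \<in> carrier (K[X])" "q0 \<noteq> []" "hd q0 = \<one>" "eval q0 x = \<zero>"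
    using int unfolding integral_over_def by blast
  then have "P q0" unfolding P_def univ_poly_carrier[symmetric] polynomial_def by auto
  then obtain q where q: "P q" and q_min: "\<And>r. P r \<Longrightarrow> length q \<le> length r"
    using ex_has_least_nat[of P q0 length] by auto
  obtain p k where qp: "q = p @ [k]" using q unfolding P_def by (metis rev_exhaust)
  have pk: "set p \<subseteq> K" "k \<in> K" using q by (auto simp: P_def qp)
  have "k \<noteq> \<zero>"
  proof
    assume k: "k = \<zero>"
    then have "p \<noteq> []" using q by (auto simp: P_def qp)
    have epc: "eval p x \<in> carrier R" using pk Kr(1) x by (intro eval_in_carrier) auto
    have "eval p x \<otimes> x = \<zero>"
      using q eval_append_aux[of p k x] pk Kr(1) x epc k by (auto simp: P_def qp)
    then have "eval p x = \<zero>" using epc x integral_iff by blast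
    then have "P p" using q \<open>p \<noteq> []\<close> by (auto simp: P_def qp)
    from q_min[OF this] show False by (simp add: qp)
  qed
  then show ?thesis using q pk unfolding qp P_def by blast
qed


lemma restrict_scalars_simps:
  "carrier (restrict_scalars S f) = carrier S" "\<zero>\<^bsub>restrict_scalars S f\<^esub> = \<zero>\<^bsub>S\<^esub>"
  "x \<oplus>\<^bsub>restrict_scalars S f\<^esub> y = x \<oplus>\<^bsub>S\<^esub> y" "r \<odot>\<^bsub>restrict_scalars S f\<^esub> x = f r \<otimes>\<^bsub>S\<^esub> x"
  "\<ominus>\<^bsub>restrict_scalars S f\<^esub> x = \<ominus>\<^bsub>S\<^esub> x"
  by (simp_all add: restrict_scalars_def a_inv_def m_inv_def)

lemma restrict_scalars_module:
  assumes R: "cring R" and S: "cring S" and f: "f \<in> ring_hom R S"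
  shows "module R (restrict_scalars S f)"
proof -
  interpret R: cring R by fact
  interpret S: cring S by fact
  interpret f: ring_hom_ring R S f by (rule ring_hom_ringI2[OF R.ring_axioms S.ring_axioms]) (use f in simp)
  show ?thesis
  proof (rule moduleI)
    show "abelian_group (restrict_scalars S f)"
      by (rule abelian_groupI)
        (auto simp: restrict_scalars_simps S.a_ac intro!: bexI[of _ "\<ominus>\<^bsub>S\<^esub> x" for x] S.l_neg)
  qed (auto simp: restrict_scalars_simps S.l_distr S.r_distr S.m_assoc R.cring_axioms)
qed

lemma finitely_generated_lin_span:
  assumes R: "cring R" and S: "cring S" and f: "f \<in> ring_hom R S"
    and fg: "finitely_generated R (restrict_scalars S f)"
  shows "\<exists>A. finite A \<and> A \<subseteq> carrier S \<and> \<one>\<^bsub>S\<^esub> \<in> A \<and> carrier S \<subseteq> ring.lin_span S (f ` carrier R) A"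
proof -
  interpret R: cring R by fact
  interpret S: cring S by fact
  interpret f: ring_hom_ring R S f by (rule ring_hom_ringI2[OF R.ring_axioms S.ring_axioms]) (use f in simp)
  interpret M: module R "restrict_scalars S f" by (rule restrict_scalars_module) fact+
  have K: "subring (f ` carrier R) S" using f.img_is_subring[OF R.carrier_is_subring] .
  obtain A0 where A0: "finite A0" "A0 \<subseteq> carrier S"
      "\<And>N. submodule N R (restrict_scalars S f) \<Longrightarrow> A0 \<subseteq> N \<Longrightarrow> N = carrier S"
    using fg by (auto simp: finitely_generated_def restrict_scalars_simps)
  define A where "A = insert \<one>\<^bsub>S\<^esub> A0"
  have A: "finite A" "A \<subseteq> carrier S" "\<one>\<^bsub>S\<^esub> \<in> A" using A0 by (auto simp: A_def)
  let ?N = "S.lin_span (f ` carrier R) A"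
  have "submodule ?N R (restrict_scalars S f)"
  proof (rule M.submoduleI)
    show "?N \<subseteq> carrier (restrict_scalars S f)"
      using S.lin_span_carrier[OF K S.one_closed A(2)] by (auto simp: restrict_scalars_simps)
  qed (auto simp: restrict_scalars_simps S.lin_span.zero
         intro!: S.lin_span_minus[OF K S.one_closed A(2)] S.lin_span_add[OF K S.one_closed A(2)]
           S.lin_span_smult[OF K S.one_closed A(2)])
  moreover have "A0 \<subseteq> ?N" using S.lin_span_gen[OF K S.one_closed A(2)] by (auto simp: A_def)
  ultimately have "?N = carrier S" using A0(3) by blast
  then show ?thesis using A by blast
qed

lemma finitely_generated_integral:
  assumes R: "cring R" and S: "domain S" and f: "f \<in> ring_hom R S"
    and fg: "finitely_generated R (restrict_scalars S f)" and s: "s \<in> carrier S"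
  shows "integral_over S (f ` carrier R) s"
proof -
  interpret R: cring R by fact
  interpret S: domain S by fact
  interpret f: ring_hom_ring R S f by (rule ring_hom_ringI2[OF R.ring_axioms S.ring_axioms]) (use f in simp)
  have K: "subring (f ` carrier R) S" using f.img_is_subring[OF R.carrier_is_subring] .
  obtain A where A: "finite A" "A \<subseteq> carrier S" "\<one>\<^bsub>S\<^esub> \<in> A" "carrier S \<subseteq> S.lin_span (f ` carrier R) A"
    using finitely_generated_lin_span[OF R S.cring_axioms f fg] by auto
  show ?thesis
    by (rule S.integral_over_if_stable[OF K s A(1-3)]) (use A s in \<open>auto intro!: subsetD[OF A(4)]\<close>)
qed

lemma (in ring) lin_span_subset_subring:
  assumes "subring N R" "K \<subseteq> N" "G \<subseteq> N" shows "lin_span K G \<subseteq> N"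
proof
  fix y assume "y \<in> lin_span K G"
  then show "y \<in> N"
  proof (induction rule: lin_span.induct)
    case zero then show ?case using subringE(2)[OF assms(1)] .
  next
    case (step a g y)
    have "a \<in> N" "g \<in> N" using step.hyps assms by auto
    then show ?case using subringE(6,7)[OF assms(1)] step.IH by simp
  qed
qed

text \<open>Two pairs over the same \<open>x\<close> differ by a pair over \<open>0\<close>, so a graph in the above sense is single-valued
  everywhere.\<close>

lemma total_hom_graph:
  assumes S: "ring S" and L: "ring L" and \<Gamma>: "partial_hom_graph S L \<Gamma>"
    and total: "carrier S \<subseteq> fst ` \<Gamma>"
  shows "\<exists>\<psi>\<in>ring_hom S L. \<forall>x l. (x, l) \<in> \<Gamma> \<longrightarrow> \<psi> x = l"
proof -
  interpret S: ring S by fact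
  interpret L: ring L by fact
  have sub: "subring \<Gamma> (RDirProd S L)" and graph: "\<And>l. (\<zero>\<^bsub>S\<^esub>, l) \<in> \<Gamma> \<Longrightarrow> l = \<zero>\<^bsub>L\<^esub>"
    using \<Gamma> by (auto simp: partial_hom_graph_def)
  interpret B: ring "RDirProd S L" by (rule RDirProd_ring) fact+
  note Gr = subringE[OF sub]
  have Gc: "x \<in> carrier S" "l \<in> carrier L" if "(x, l) \<in> \<Gamma>" for x l
    using Gr(1) that by (auto simp: RDirProd_simps)
  have Gadd: "(x \<oplus>\<^bsub>S\<^esub> y, l \<oplus>\<^bsub>L\<^esub> k) \<in> \<Gamma>" and Gmult: "(x \<otimes>\<^bsub>S\<^esub> y, l \<otimes>\<^bsub>L\<^esub> k) \<in> \<Gamma>"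
    if "(x, l) \<in> \<Gamma>" "(y, k) \<in> \<Gamma>" for x y l k
    using Gr(6,7)[OF that] by (auto simp: RDirProd_simps)
  have unique: "l = k" if "(x, l) \<in> \<Gamma>" "(x, k) \<in> \<Gamma>" for x l k
  proof -
    note c = Gc[OF that(1)] Gc[OF that(2)]
    have "(\<ominus>\<^bsub>S\<^esub> x, \<ominus>\<^bsub>L\<^esub> k) \<in> \<Gamma>"
    proof -
      have "\<ominus>\<^bsub>RDirProd S L\<^esub> (x, k) = (\<ominus>\<^bsub>S\<^esub> x, \<ominus>\<^bsub>L\<^esub> k)"
        using c by (intro B.minus_equality) (simp_all add: RDirProd_simps S.l_neg L.l_neg)
      then show ?thesis using Gr(5)[OF that(2)] by simp
    qed
    from Gadd[OF that(1) this] have "(\<zero>\<^bsub>S\<^esub>, l \<ominus>\<^bsub>L\<^esub> k) \<in> \<Gamma>"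
      using c by (simp add: S.r_neg a_minus_def)
    then have "l \<ominus>\<^bsub>L\<^esub> k = \<zero>\<^bsub>L\<^esub>" by (rule graph)
    then show ?thesis using c by simp
  qed
  define \<psi> where "\<psi> x = (THE l. (x, l) \<in> \<Gamma>)" for x
  have \<psi>I: "\<psi> x = l" if "(x, l) \<in> \<Gamma>" for x l
    unfolding \<psi>_def using that unique by blast
  have \<psi>: "(x, \<psi> x) \<in> \<Gamma>" if "x \<in> carrier S" for x
  proof -
    obtain l where "(x, l) \<in> \<Gamma>" using subsetD[OF total \<open>x \<in> carrier S\<close>] by auto
    then show ?thesis using \<psi>I by simp
  qed
  have "\<psi> \<in> ring_hom S L"
  proof (rule ring_hom_memI)
    show "\<psi> \<one>\<^bsub>S\<^esub> = \<one>\<^bsub>L\<^esub>" using Gr(3) by (intro \<psi>I) (simp add: RDirProd_simps)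
    show "\<psi> x \<in> carrier L" if "x \<in> carrier S" for x using Gc(2)[OF \<psi>[OF that]] .
    show "\<psi> (x \<otimes>\<^bsub>S\<^esub> y) = \<psi> x \<otimes>\<^bsub>L\<^esub> \<psi> y" if "x \<in> carrier S" "y \<in> carrier S" for x y
      by (rule \<psi>I[OF Gmult[OF \<psi>[OF that(1)] \<psi>[OF that(2)]]])
    show "\<psi> (x \<oplus>\<^bsub>S\<^esub> y) = \<psi> x \<oplus>\<^bsub>L\<^esub> \<psi> y" if "x \<in> carrier S" "y \<in> carrier S" for x y
      by (rule \<psi>I[OF Gadd[OF \<psi>[OF that(1)] \<psi>[OF that(2)]]])
  qed
  then show ?thesis using \<psi>I by blast
qed

text \<open>The generators of \<open>S\<close> are adjoined one at a time. Injectivity of the partial homomorphisms does not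
  have to be carried along: it is automatic, because \<open>S\<close> is integral over \<open>R\<close> and \<open>\<iota>\<close> is injective.\<close>

lemma extend_hom_to_alg_closed:
  assumes R: "domain R" and S: "domain S" and L: "algebraically_closed L"
    and f: "f \<in> ring_hom R S" "inj_on f (carrier R)" and \<iota>: "\<iota> \<in> ring_hom R L" "inj_on \<iota> (carrier R)"
    and fg: "finitely_generated R (restrict_scalars S f)"
  shows "\<exists>\<psi>\<in>ring_hom S L. \<forall>r\<in>carrier R. \<psi> (f r) = \<iota> r"
proof -
  interpret R: domain R by fact
  interpret S: domain S by fact
  interpret L: algebraically_closed L by fact
  interpret B: cring "RDirProd S L" by (rule RDirProd_cring) unfold_locales
  interpret p1: ring_hom_ring "RDirProd S L" S fst by (rule RDirProd_fst_hom) unfold_locales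
  interpret p2: ring_hom_ring "RDirProd S L" L snd by (rule RDirProd_snd_hom) unfold_locales
  interpret f: ring_hom_ring R S f by (rule ring_hom_ringI2[OF R.ring_axioms S.ring_axioms]) (use f in simp)
  interpret i: ring_hom_ring R L \<iota> by (rule ring_hom_ringI2[OF R.ring_axioms L.ring_axioms]) (use \<iota> in simp)
  let ?K = "f ` carrier R"
  have K: "subring ?K S" using f.img_is_subring[OF R.carrier_is_subring] .
  \<comment> \<open>Relations over \<open>f(R)\<close> are lifted to the graph through \<open>j\<close>.\<close>
  define j where "j y = (y, \<iota> (inv_into (carrier R) f y))" for y
  have jf: "j (f r) = (f r, \<iota> r)" if "r \<in> carrier R" for r
    using that f by (simp add: j_def)
  define \<Gamma>0 where "\<Gamma>0 = (\<lambda>r. (f r, \<iota> r)) ` carrier R"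
  have \<Gamma>0I: "(f r, \<iota> r) \<in> \<Gamma>0" if "r \<in> carrier R" for r
    unfolding \<Gamma>0_def using that by (rule imageI)
  have d: "ring_hom_ring R (RDirProd S L) (\<lambda>r. (f r, \<iota> r))"
    by (rule ring_hom_ringI) (auto simp: RDirProd_simps B.ring_axioms R.ring_axioms)
  have sub0: "subring \<Gamma>0 (RDirProd S L)"
    unfolding \<Gamma>0_def using ring_hom_ring.img_is_subring[OF d R.carrier_is_subring] .
  have zero_f: "r = \<zero>\<^bsub>R\<^esub>" if "r \<in> carrier R" "f r = \<zero>\<^bsub>S\<^esub>" for r
    using that f(2) by (metis R.zero_closed f.hom_zero inj_onD)
  have zero_i: "r = \<zero>\<^bsub>R\<^esub>" if "r \<in> carrier R" "\<iota> r = \<zero>\<^bsub>L\<^esub>" for r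
    using that \<iota>(2) by (metis R.zero_closed i.hom_zero inj_onD)
  have graph0: "partial_hom_graph S L \<Gamma>0"
    unfolding partial_hom_graph_def
  proof (intro conjI sub0 allI impI)
    fix l assume "(\<zero>\<^bsub>S\<^esub>, l) \<in> \<Gamma>0"
    then obtain r where r: "(\<zero>\<^bsub>S\<^esub>, l) = (f r, \<iota> r)" "r \<in> carrier R"
      unfolding \<Gamma>0_def by (rule imageE)
    then have "f r = \<zero>\<^bsub>S\<^esub>" "l = \<iota> r" by simp_all
    with zero_f[OF r(2)] show "l = \<zero>\<^bsub>L\<^esub>" by simp
  qed
  have jK: "set (map j p) \<subseteq> \<Gamma>0" "map fst (map j p) = p" if "set p \<subseteq> ?K" for p
  proof -
    show "set (map j p) \<subseteq> \<Gamma>0" using that jf by (auto simp: \<Gamma>0_def)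
    show "map fst (map j p) = p" by (induction p) (auto simp: j_def)
  qed
  have int: "integral_over S ?K s" if "s \<in> carrier S" for s
    by (rule finitely_generated_integral) (use R.cring_axioms S f fg that in auto)
  have inj: "b = \<zero>\<^bsub>S\<^esub>" if \<Gamma>: "partial_hom_graph S L \<Gamma>" "\<Gamma>0 \<subseteq> \<Gamma>" and b: "(b, \<zero>\<^bsub>L\<^esub>) \<in> \<Gamma>" for \<Gamma> b
  proof (rule ccontr)
    assume nz: "b \<noteq> \<zero>\<^bsub>S\<^esub>"
    have sub: "subring \<Gamma> (RDirProd S L)" using \<Gamma> by (simp add: partial_hom_graph_def)
    have bB: "(b, \<zero>\<^bsub>L\<^esub>) \<in> carrier (RDirProd S L)" using subringE(1)[OF sub] b by auto
    then have bc: "b \<in> carrier S" by (simp add: RDirProd_simps)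
    obtain p k where p: "set p \<subseteq> ?K" "k \<in> ?K" "k \<noteq> \<zero>\<^bsub>S\<^esub>" "S.eval (p @ [k]) b = \<zero>\<^bsub>S\<^esub>"
      using S.integral_nonzero_const_term[OF K bc nz int[OF bc]] by auto
    \<comment> \<open>The equation is evaluated at \<open>(b, 0)\<close> in the graph: the first component vanishes, and the
      second one is the image of the constant term.\<close>
    define h where "h = map j (p @ [k])"
    have h: "set h \<subseteq> \<Gamma>" "map fst h = p @ [k]"
      using jK[of "p @ [k]"] p \<Gamma>(2) unfolding h_def by auto
    have hB: "set h \<subseteq> carrier (RDirProd S L)" using h subringE(1)[OF sub] by auto
    interpret G: ring "RDirProd S L \<lparr>carrier := \<Gamma>\<rparr>" using B.subring_is_ring[OF sub] .
    have "B.eval h (b, \<zero>\<^bsub>L\<^esub>) \<in> \<Gamma>"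
      using G.eval_in_carrier[of h "(b, \<zero>\<^bsub>L\<^esub>)"] h b B.eval_consistent[OF sub] by simp
    moreover have "fst (B.eval h (b, \<zero>\<^bsub>L\<^esub>)) = \<zero>\<^bsub>S\<^esub>"
      using p1.eval_hom'[OF bB hB] h p by simp
    ultimately have "snd (B.eval h (b, \<zero>\<^bsub>L\<^esub>)) = \<zero>\<^bsub>L\<^esub>"
      using \<Gamma>(1) unfolding partial_hom_graph_def by (metis prod.collapse)
    moreover have "snd (B.eval h (b, \<zero>\<^bsub>L\<^esub>)) = snd (j k)"
    proof -
      have c: "set (map snd (map j p)) \<subseteq> carrier L" "snd (j k) \<in> carrier L"
        using hB by (auto simp: h_def RDirProd_simps)
      have "L.eval (map snd (map j p) @ [snd (j k)]) \<zero>\<^bsub>L\<^esub>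
          = L.eval (map snd (map j p)) \<zero>\<^bsub>L\<^esub> \<otimes>\<^bsub>L\<^esub> \<zero>\<^bsub>L\<^esub> \<oplus>\<^bsub>L\<^esub> snd (j k)"
        by (rule L.eval_append_aux[OF c]) simp
      then show ?thesis
        using p2.eval_hom'[OF bB hB] L.eval_in_carrier[OF c(1), of "\<zero>\<^bsub>L\<^esub>"] c(2) by (simp add: h_def)
    qed
    moreover obtain r where r: "r \<in> carrier R" "k = f r" using p by auto
    ultimately have "\<iota> r = \<zero>\<^bsub>L\<^esub>" using jf[OF r(1)] by simp
    then show False using zero_i[OF r(1)] p(3) r by simp
  qed
  have ex: "\<exists>\<Gamma>. partial_hom_graph S L \<Gamma> \<and> \<Gamma>0 \<subseteq> \<Gamma> \<and> A \<subseteq> fst ` \<Gamma>" if "finite A" "A \<subseteq> carrier S" for A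
    using that
  proof (induction A rule: finite_induct)
    case empty then show ?case using graph0 by auto
  next
    case (insert s A)
    then obtain \<Gamma> where \<Gamma>: "partial_hom_graph S L \<Gamma>" "\<Gamma>0 \<subseteq> \<Gamma>" "A \<subseteq> fst ` \<Gamma>" by auto
    obtain q where q: "q \<in> carrier (univ_poly S ?K)" "q \<noteq> []" "hd q = \<one>\<^bsub>S\<^esub>" "S.eval q s = \<zero>\<^bsub>S\<^esub>"
      using int[of s] insert unfolding integral_over_def by auto
    have qK: "set q \<subseteq> ?K"
      using q(1) unfolding univ_poly_carrier[symmetric] polynomial_def by auto
    have "set (map j q) \<subseteq> \<Gamma>" using jK(1)[OF qK] \<Gamma>(2) by (rule order_trans)
    moreover have "map j q \<noteq> []" using q(2) by simp
    moreover have "fst (hd (map j q)) \<noteq> \<zero>\<^bsub>S\<^esub>" using q(2,3) by (simp add: j_def hd_map)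
    moreover have "S.eval (map fst (map j q)) s = \<zero>\<^bsub>S\<^esub>" unfolding jK(2)[OF qK] by (rule q(4))
    ultimately have "\<exists>p. set p \<subseteq> \<Gamma> \<and> p \<noteq> [] \<and> fst (hd p) \<noteq> \<zero>\<^bsub>S\<^esub> \<and> S.eval (map fst p) s = \<zero>\<^bsub>S\<^esub>"
      by (intro exI[of _ "map j q"] conjI)
    from partial_hom_graph_adjoin[OF S L \<Gamma>(1) inj[OF \<Gamma>(1,2)] _ this] insert.prems
    obtain \<Gamma>' where "partial_hom_graph S L \<Gamma>'" "\<Gamma> \<subseteq> \<Gamma>'" "s \<in> fst ` \<Gamma>'"
      by auto
    note \<Gamma>' = this
    have "A \<subseteq> fst ` \<Gamma>'" using \<Gamma>(3) image_mono[OF \<Gamma>'(2), of fst] by (rule order_trans)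
    moreover have "\<Gamma>0 \<subseteq> \<Gamma>'" using \<Gamma>(2) \<Gamma>'(2) by (rule order_trans)
    ultimately show ?case using \<Gamma>'(1,3) by blast
  qed
  obtain A where A: "finite A" "A \<subseteq> carrier S" "carrier S \<subseteq> S.lin_span ?K A"
    using finitely_generated_lin_span[OF R.cring_axioms S.cring_axioms f(1) fg] by auto
  obtain \<Gamma> where \<Gamma>: "partial_hom_graph S L \<Gamma>" "\<Gamma>0 \<subseteq> \<Gamma>" "A \<subseteq> fst ` \<Gamma>"
    using ex[OF A(1,2)] by (elim exE conjE)
  \<comment> \<open>The domain of definition is a subring containing the image of \<open>R\<close> and the generators.\<close>
  have "subring (fst ` \<Gamma>) S"
    using p1.img_is_subring \<Gamma>(1) unfolding partial_hom_graph_def by blast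
  moreover have "?K \<subseteq> fst ` \<Gamma>"
  proof
    fix y assume "y \<in> ?K"
    then obtain r where r: "y = f r" "r \<in> carrier R" by (rule imageE)
    show "y \<in> fst ` \<Gamma>"
      by (rule image_eqI[OF _ subsetD[OF \<Gamma>(2) \<Gamma>0I[OF r(2)]]]) (simp only: r fst_conv)
  qed
  ultimately have "carrier S \<subseteq> fst ` \<Gamma>"
    using S.lin_span_subset_subring \<Gamma>(3) A(3) by (meson order_trans)
  from total_hom_graph[OF S.ring_axioms L.ring_axioms \<Gamma>(1) this] obtain \<psi>
    where \<psi>: "\<psi> \<in> ring_hom S L" "\<And>x l. (x, l) \<in> \<Gamma> \<Longrightarrow> \<psi> x = l" by auto
  show ?thesis
    by (rule bexI[OF _ \<psi>(1)]) (use \<psi>(2) subsetD[OF \<Gamma>(2) \<Gamma>0I] in blast)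
qed

section \<open>Dual bases of finitely generated projective modules\<close>

lemma mod_hom_zero:
  assumes M: "module R M" and N: "module R N" and h: "h \<in> mod_hom R M N"
  shows "h \<zero>\<^bsub>M\<^esub> = \<zero>\<^bsub>N\<^esub>"
proof -
  interpret M: module R M by fact
  interpret N: module R N by fact
  have "h \<zero>\<^bsub>M\<^esub> = h (\<zero>\<^bsub>R\<^esub> \<odot>\<^bsub>M\<^esub> \<zero>\<^bsub>M\<^esub>)" by simp
  also have "\<dots> = \<zero>\<^bsub>R\<^esub> \<odot>\<^bsub>N\<^esub> h \<zero>\<^bsub>M\<^esub>"
    using h M.zero_closed M.R.zero_closed unfolding mod_hom_def by blast
  also have "\<dots> = \<zero>\<^bsub>N\<^esub>"
    using h by (intro N.smult_l_null) (auto simp: mod_hom_def)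
  finally show ?thesis .
qed

lemma mod_hom_finsum:
  assumes M: "module R M" and N: "module R N" and h: "h \<in> mod_hom R M N"
    and J: "finite J" "\<And>j. j \<in> J \<Longrightarrow> a j \<in> carrier R" "\<And>j. j \<in> J \<Longrightarrow> m j \<in> carrier M"
  shows "h (\<Oplus>\<^bsub>M\<^esub>j\<in>J. a j \<odot>\<^bsub>M\<^esub> m j) = (\<Oplus>\<^bsub>N\<^esub>j\<in>J. a j \<odot>\<^bsub>N\<^esub> h (m j))"
  using J
proof (induction J rule: finite_induct)
  case empty
  interpret M: module R M by fact
  interpret N: module R N by fact
  show ?case using mod_hom_zero[OF M N h] by simp
next
  case (insert j J)
  interpret M: module R M by fact
  interpret N: module R N by fact
  have hc: "h x \<in> carrier N" if "x \<in> carrier M" for x using h that by (auto simp: mod_hom_def)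
  have "h (\<Oplus>\<^bsub>M\<^esub>j\<in>insert j J. a j \<odot>\<^bsub>M\<^esub> m j) = h (a j \<odot>\<^bsub>M\<^esub> m j \<oplus>\<^bsub>M\<^esub> (\<Oplus>\<^bsub>M\<^esub>j\<in>J. a j \<odot>\<^bsub>M\<^esub> m j))"
    using insert by (subst M.finsum_insert) auto
  also have "\<dots> = a j \<odot>\<^bsub>N\<^esub> h (m j) \<oplus>\<^bsub>N\<^esub> h (\<Oplus>\<^bsub>M\<^esub>j\<in>J. a j \<odot>\<^bsub>M\<^esub> m j)"
  proof -
    have "a j \<odot>\<^bsub>M\<^esub> m j \<in> carrier M" "(\<Oplus>\<^bsub>M\<^esub>j\<in>J. a j \<odot>\<^bsub>M\<^esub> m j) \<in> carrier M"
      using insert by (auto intro!: M.finsum_closed)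
    then show ?thesis using h insert by (simp add: mod_hom_def)
  qed
  also have "\<dots> = (\<Oplus>\<^bsub>N\<^esub>j\<in>insert j J. a j \<odot>\<^bsub>N\<^esub> h (m j))"
    using insert hc by (subst N.finsum_insert) auto
  finally show ?case .
qed

lemma finsum_restrict_scalars: "finsum (restrict_scalars S f) g I = finsum S g I"
  by (simp add: finsum_def finprod_def restrict_scalars_def)

lemma regular_module_simps:
  "carrier (regular_module R) = carrier R" "\<zero>\<^bsub>regular_module R\<^esub> = \<zero>\<^bsub>R\<^esub>"
  "x \<oplus>\<^bsub>regular_module R\<^esub> y = x \<oplus>\<^bsub>R\<^esub> y" "r \<odot>\<^bsub>regular_module R\<^esub> x = r \<otimes>\<^bsub>R\<^esub> x"
  "finsum (regular_module R) g I = finsum R g I"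
  by (simp_all add: regular_module_def restrict_scalars_simps finsum_restrict_scalars)

lemma regular_module_module: "cring R \<Longrightarrow> module R (regular_module R)"
  unfolding regular_module_def by (rule restrict_scalars_module) (auto simp: ring_hom_def)

lemma free_module_memI:
  assumes "v \<in> I \<rightarrow>\<^sub>E carrier R" "finite J" "\<And>i. i \<in> I - J \<Longrightarrow> v i = \<zero>\<^bsub>R\<^esub>"
  shows "v \<in> carrier (free_module R I)"
proof -
  have "{i \<in> I. v i \<noteq> \<zero>\<^bsub>R\<^esub>} \<subseteq> J" using assms(3) by blast
  then show ?thesis using assms(1,2) by (simp add: free_module_def finite_subset)
qed

lemma free_module_unit_vector:
  assumes "cring R" shows "(\<lambda>i\<in>I. if i = k then \<one>\<^bsub>R\<^esub> else \<zero>\<^bsub>R\<^esub>) \<in> carrier (free_module R I)"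
proof (rule free_module_memI[where J = "{k}"])
  interpret cring R by fact
  show "(\<lambda>i\<in>I. if i = k then \<one>\<^bsub>R\<^esub> else \<zero>\<^bsub>R\<^esub>) \<in> I \<rightarrow>\<^sub>E carrier R"
    by (simp add: restrict_PiE_iff)
qed simp_all

lemma free_module_hom_expansion:
  fixes R :: "('a, 'x) ring_scheme" and P :: "('a, 'm) module"
  assumes R: "cring R" and P: "module R P" and r: "r \<in> mod_hom R (free_module R I) P"
    and "finite J" "J \<subseteq> I" "v \<in> carrier (free_module R I)" "\<And>i. i \<in> I - J \<Longrightarrow> v i = \<zero>\<^bsub>R\<^esub>"
  shows "r v = (\<Oplus>\<^bsub>P\<^esub>j\<in>J. v j \<odot>\<^bsub>P\<^esub> r (\<lambda>i\<in>I. if i = j then \<one>\<^bsub>R\<^esub> else \<zero>\<^bsub>R\<^esub>))"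
proof -
  interpret R: cring R by fact
  interpret P: module R P by fact
  let ?F = "free_module R I"
  let ?e = "\<lambda>j. \<lambda>i\<in>I. if i = j then \<one>\<^bsub>R\<^esub> else \<zero>\<^bsub>R\<^esub>"
  have r_closed: "r v \<in> carrier P" if "v \<in> carrier ?F" for v
    using r that by (auto simp: mod_hom_def)
  have r_add: "r (v \<oplus>\<^bsub>?F\<^esub> w) = r v \<oplus>\<^bsub>P\<^esub> r w" if "v \<in> carrier ?F" "w \<in> carrier ?F" for v w
    using r that by (auto simp: mod_hom_def)
  have r_smult: "r (a \<odot>\<^bsub>?F\<^esub> v) = a \<odot>\<^bsub>P\<^esub> r v" if "a \<in> carrier R" "v \<in> carrier ?F" for a v
    using r that by (auto simp: mod_hom_def)
  have FR: "v i \<in> carrier R" if "v \<in> carrier ?F" "i \<in> I" for v i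
    using that by (auto simp: free_module_def)
  have Fext: "v i = undefined" if "v \<in> carrier ?F" "i \<notin> I" for v i
    using that by (auto simp: free_module_def)
  have e: "?e k \<in> carrier ?F" for k
    by (rule free_module_unit_vector[OF R])
  show ?thesis using assms(4-)
  proof (induction J arbitrary: v rule: finite_induct)
    case empty
    have "\<zero>\<^bsub>R\<^esub> \<odot>\<^bsub>?F\<^esub> v = v"
    proof
      fix i show "(\<zero>\<^bsub>R\<^esub> \<odot>\<^bsub>?F\<^esub> v) i = v i"
        using empty.prems(3)[of i] Fext[OF empty.prems(2), of i] by (simp add: free_module_def)
    qed
    then have "r v = \<zero>\<^bsub>R\<^esub> \<odot>\<^bsub>P\<^esub> r v" using r_smult[of "\<zero>\<^bsub>R\<^esub>" v] empty.prems(2) by simp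
    also have "\<dots> = \<zero>\<^bsub>P\<^esub>" by (rule P.smult_l_null[OF r_closed[OF empty.prems(2)]])
    finally show ?case by simp
  next
    case (insert j J)
    note v = insert.prems(2)
    have jI: "j \<in> I" "J \<subseteq> I" using insert.prems(1) by auto
    define v' where "v' = v(j := \<zero>\<^bsub>R\<^esub>)"
    have v'0: "v' i = \<zero>\<^bsub>R\<^esub>" if "i \<in> I - J" for i
      using insert.prems(3)[of i] that by (simp add: v'_def)
    have v'v: "v' k = v k" if "k \<in> J" for k
      using that insert.hyps(2) by (auto simp: v'_def)
    have v': "v' \<in> carrier ?F"
    proof (rule free_module_memI[of _ _ _ J])
      show "v' \<in> I \<rightarrow>\<^sub>E carrier R"
        using FR[OF v] Fext[OF v] jI by (auto simp: v'_def)
    qed (rule insert.hyps(1), rule v'0)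
    have ve: "v j \<odot>\<^bsub>?F\<^esub> ?e j \<in> carrier ?F"
      by (rule free_module_memI[of _ _ _ "{j}"]) (use FR[OF v jI(1)] in \<open>auto simp: free_module_def\<close>)
    have "v = (v j \<odot>\<^bsub>?F\<^esub> ?e j) \<oplus>\<^bsub>?F\<^esub> v'"
    proof
      fix i
      show "v i = ((v j \<odot>\<^bsub>?F\<^esub> ?e j) \<oplus>\<^bsub>?F\<^esub> v') i"
        using FR[OF v, of i] FR[OF v jI(1)] Fext[OF v, of i] jI(1)
        by (simp add: free_module_def v'_def)
    qed
    then have "r v = r ((v j \<odot>\<^bsub>?F\<^esub> ?e j) \<oplus>\<^bsub>?F\<^esub> v')" by (rule arg_cong)
    also have "\<dots> = v j \<odot>\<^bsub>P\<^esub> r (?e j) \<oplus>\<^bsub>P\<^esub> r v'"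
      unfolding r_add[OF ve v'] r_smult[OF FR[OF v jI(1)] e] ..
    also have "r v' = (\<Oplus>\<^bsub>P\<^esub>k\<in>J. v' k \<odot>\<^bsub>P\<^esub> r (?e k))"
      by (rule insert.IH[OF jI(2) v' v'0])
    also have "\<dots> = (\<Oplus>\<^bsub>P\<^esub>k\<in>J. v k \<odot>\<^bsub>P\<^esub> r (?e k))"
    proof (rule P.finsum_cong')
      show "(\<lambda>k. v k \<odot>\<^bsub>P\<^esub> r (?e k)) \<in> J \<rightarrow> carrier P"
        using FR[OF v] r_closed[OF e] jI(2) by (intro Pi_I P.smult_closed) auto
      show "v' k \<odot>\<^bsub>P\<^esub> r (?e k) = v k \<odot>\<^bsub>P\<^esub> r (?e k)" if "k \<in> J" for k
        using v'v[OF that] by (rule arg_cong)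
    qed (rule refl)
    also have "v j \<odot>\<^bsub>P\<^esub> r (?e j) \<oplus>\<^bsub>P\<^esub> \<dots> = (\<Oplus>\<^bsub>P\<^esub>k\<in>insert j J. v k \<odot>\<^bsub>P\<^esub> r (?e k))"
    proof (rule P.finsum_insert[OF insert.hyps(1,2), symmetric])
      show "(\<lambda>k. v k \<odot>\<^bsub>P\<^esub> r (?e k)) \<in> J \<rightarrow> carrier P"
        using FR[OF v] r_closed[OF e] jI(2) by (intro Pi_I P.smult_closed) auto
      show "v j \<odot>\<^bsub>P\<^esub> r (?e j) \<in> carrier P"
        by (rule P.smult_closed[OF FR[OF v jI(1)] r_closed[OF e]])
    qed
    finally show ?case .
  qed
qed

text \<open>The finite form of the dual basis property: the coordinate forms \<open>\<xi> j\<close> and the elements \<open>g j\<close> express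
  \<open>P\<close> as a direct summand of the free module on \<open>J\<close>.\<close>

definition finite_dual_basis ::
    "('a, 'x) ring_scheme \<Rightarrow> ('a, 'm) module \<Rightarrow> 'i set \<Rightarrow> ('i \<Rightarrow> 'm) \<Rightarrow> ('i \<Rightarrow> 'm \<Rightarrow> 'a) \<Rightarrow> bool" where
  "finite_dual_basis R P J g \<xi> \<longleftrightarrow> finite J \<and> (\<forall>j\<in>J. g j \<in> carrier P) \<and>
     (\<forall>j\<in>J. \<xi> j \<in> carrier (hom_module R P (regular_module R))) \<and>
     (\<forall>x\<in>carrier P. x = (\<Oplus>\<^bsub>P\<^esub>j\<in>J. \<xi> j x \<odot>\<^bsub>P\<^esub> g j))"

text \<open>The section \<open>s\<close> of a surjection \<open>r\<close> from a free module maps the finitely many generators, and hence all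
  of \<open>P\<close>, to vectors supported on a finite set \<open>J\<close>. The coordinates of \<open>s\<close> and the images of the unit
  vectors in \<open>J\<close> form a dual basis.\<close>

lemma projective_finite_dual_basis:
  fixes P :: "('a, 'm) module"
  assumes R: "cring R" and proj: "projective_module R P" and fg: "finitely_generated R P"
  shows "\<exists>(J::'m set) g \<xi>. finite_dual_basis R P J g \<xi>"
proof -
  interpret R: cring R by fact
  obtain I :: "'m set" and s r where P: "module R P" and s: "s \<in> mod_hom R P (free_module R I)"
      and r: "r \<in> mod_hom R (free_module R I) P" and rs: "\<And>x. x \<in> carrier P \<Longrightarrow> r (s x) = x"
    using proj by (auto simp: projective_module_def)
  interpret P: module R P by fact
  obtain B where B: "finite B" "B \<subseteq> carrier P" "\<And>N. submodule N R P \<Longrightarrow> B \<subseteq> N \<Longrightarrow> N = carrier P"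
    using fg by (auto simp: finitely_generated_def)
  have sF: "s x \<in> carrier (free_module R I)" if "x \<in> carrier P" for x
    using s that by (auto simp: mod_hom_def)
  have sR: "s x i \<in> carrier R" if "x \<in> carrier P" "i \<in> I" for x i
    using sF[OF that(1)] that by (auto simp: free_module_def)
  have s_add: "s (x \<oplus>\<^bsub>P\<^esub> y) i = s x i \<oplus>\<^bsub>R\<^esub> s y i" if "x \<in> carrier P" "y \<in> carrier P" "i \<in> I" for x y i
    using s that by (auto simp: mod_hom_def free_module_def)
  have s_smult: "s (a \<odot>\<^bsub>P\<^esub> x) i = a \<otimes>\<^bsub>R\<^esub> s x i" if "a \<in> carrier R" "x \<in> carrier P" "i \<in> I" for a x i
    using s that by (auto simp: mod_hom_def free_module_def)
  define J where "J = (\<Union>b\<in>B. {i \<in> I. s b i \<noteq> \<zero>\<^bsub>R\<^esub>})"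
  have J: "finite J" "J \<subseteq> I" using B sF by (auto simp: J_def free_module_def subset_iff)
  let ?N = "{x \<in> carrier P. \<forall>i\<in>I - J. s x i = \<zero>\<^bsub>R\<^esub>}"
  have "submodule ?N R P"
  proof (rule P.submoduleI)
    have "s \<zero>\<^bsub>P\<^esub> i = \<zero>\<^bsub>R\<^esub>" if "i \<in> I" for i
      using s_smult[of "\<zero>\<^bsub>R\<^esub>" "\<zero>\<^bsub>P\<^esub>" i] sR[of "\<zero>\<^bsub>P\<^esub>" i] that by simp
    then show "\<zero>\<^bsub>P\<^esub> \<in> ?N" by simp
    show "\<ominus>\<^bsub>P\<^esub> a \<in> ?N" if "a \<in> ?N" for a
    proof -
      have "\<ominus>\<^bsub>P\<^esub> a = (\<ominus>\<^bsub>R\<^esub> \<one>\<^bsub>R\<^esub>) \<odot>\<^bsub>P\<^esub> a" using that by (simp add: P.smult_l_minus)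
      then show ?thesis using that s_smult[of "\<ominus>\<^bsub>R\<^esub> \<one>\<^bsub>R\<^esub>" a] by simp
    qed
  qed (use s_add s_smult in auto)
  moreover have "B \<subseteq> ?N" using B by (auto simp: J_def)
  ultimately have "?N = carrier P" using B(3) by blast
  then have supp: "s x i = \<zero>\<^bsub>R\<^esub>" if "x \<in> carrier P" "i \<in> I - J" for x i using that by auto
  define g where "g j = r (\<lambda>i\<in>I. if i = j then \<one>\<^bsub>R\<^esub> else \<zero>\<^bsub>R\<^esub>)" for j
  define \<xi> where "\<xi> j = (\<lambda>x\<in>carrier P. s x j)" for j
  have "g j \<in> carrier P" if "j \<in> J" for j
  proof -
    have "(\<lambda>i\<in>I. if i = j then \<one>\<^bsub>R\<^esub> else \<zero>\<^bsub>R\<^esub>) \<in> carrier (free_module R I)"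
      by (rule free_module_unit_vector[OF R])
    then show ?thesis using r by (auto simp: g_def mod_hom_def)
  qed
  moreover have "\<xi> j \<in> carrier (hom_module R P (regular_module R))" if "j \<in> J" for j
    using that J sR s_add s_smult
    by (auto simp: \<xi>_def hom_module_def mod_hom_def regular_module_simps)
  moreover have "x = (\<Oplus>\<^bsub>P\<^esub>j\<in>J. \<xi> j x \<odot>\<^bsub>P\<^esub> g j)" if x: "x \<in> carrier P" for x
  proof -
    have "r (s x) = (\<Oplus>\<^bsub>P\<^esub>j\<in>J. s x j \<odot>\<^bsub>P\<^esub> g j)"
      unfolding g_def by (rule free_module_hom_expansion[OF R P r J sF[OF x] supp[OF x]])
    then show ?thesis using rs[OF x] x by (simp add: \<xi>_def)
  qed
  ultimately show ?thesis using J unfolding finite_dual_basis_def by blast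
qed

section \<open>Tensor products with modules of linear forms\<close>

text \<open>The carrier of \<open>M\<close> is described by its closure properties, so that the setting applies both to a module of linear
  forms and to its subset of coboundaries. Identities in the tensor product are stated as membership of
  differences of formal sums in the group of relations.\<close>

locale tensor_setting = R?: cring R + A: cring A
  for R :: "('a, 'x) ring_scheme" and A :: "('l, 'z) ring_scheme" and \<iota> :: "'a \<Rightarrow> 'l"
    and M :: "('a, 'm) module" +
  assumes hom: "\<iota> \<in> ring_hom R A"
    and add_M: "\<lbrakk>x \<in> carrier M; y \<in> carrier M\<rbrakk> \<Longrightarrow> x \<oplus>\<^bsub>M\<^esub> y \<in> carrier M"
    and smult_M: "\<lbrakk>r \<in> carrier R; x \<in> carrier M\<rbrakk> \<Longrightarrow> r \<odot>\<^bsub>M\<^esub> x \<in> carrier M"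
begin

abbreviation "Rel \<equiv> tensor_relations R A \<iota> M"

lemma iota_closed: "r \<in> carrier R \<Longrightarrow> \<iota> r \<in> carrier A"
  using hom by (rule ring_hom_closed)

lemma Rel_subgroup: "subgroup Rel (tensor_free A M)"
proof -
  interpret group "tensor_free A M" by (simp add: tensor_free_def)
  have keys3: "Poly_Mapping.keys (frag_of u - frag_of v - frag_of w) \<subseteq> {u, v, w}" for u v w :: "'l \<times> 'm"
    using keys_diff[of "frag_of u - frag_of v" "frag_of w"] keys_diff[of "frag_of u" "frag_of v"]
    by (auto simp: keys_frag_of)
  have keys2: "Poly_Mapping.keys (frag_of u - frag_of v) \<subseteq> {u, v}" for u v :: "'l \<times> 'm"
    using keys_diff[of "frag_of u" "frag_of v"] by (auto simp: keys_frag_of)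
  show ?thesis
    unfolding tensor_relations_def
  proof (rule generate_is_subgroup, unfold Un_subset_iff, intro conjI subsetI)
    fix x assume "x \<in> {frag_of (b \<oplus>\<^bsub>A\<^esub> b', m) - frag_of (b, m) - frag_of (b', m) |b b' m.
      b \<in> carrier A \<and> b' \<in> carrier A \<and> m \<in> carrier M}"
    then obtain b b' m where "x = frag_of (b \<oplus>\<^bsub>A\<^esub> b', m) - frag_of (b, m) - frag_of (b', m)"
      "b \<in> carrier A" "b' \<in> carrier A" "m \<in> carrier M" by blast
    then show "x \<in> carrier (tensor_free A M)"
      using keys3[of "(b \<oplus>\<^bsub>A\<^esub> b', m)" "(b, m)" "(b', m)"] by (auto simp: tensor_free_def)
  next
    fix x assume "x \<in> {frag_of (b, m \<oplus>\<^bsub>M\<^esub> m') - frag_of (b, m) - frag_of (b, m') |b m m'.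
      b \<in> carrier A \<and> m \<in> carrier M \<and> m' \<in> carrier M}"
    then obtain b m m' where "x = frag_of (b, m \<oplus>\<^bsub>M\<^esub> m') - frag_of (b, m) - frag_of (b, m')"
      "b \<in> carrier A" "m \<in> carrier M" "m' \<in> carrier M" by blast
    then show "x \<in> carrier (tensor_free A M)"
      using keys3[of "(b, m \<oplus>\<^bsub>M\<^esub> m')" "(b, m)" "(b, m')"] add_M[of m m'] by (auto simp: tensor_free_def)
  next
    fix x assume "x \<in> {frag_of (b \<otimes>\<^bsub>A\<^esub> \<iota> r, m) - frag_of (b, r \<odot>\<^bsub>M\<^esub> m) |b r m.
      b \<in> carrier A \<and> r \<in> carrier R \<and> m \<in> carrier M}"
    then obtain b r m where "x = frag_of (b \<otimes>\<^bsub>A\<^esub> \<iota> r, m) - frag_of (b, r \<odot>\<^bsub>M\<^esub> m)"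
      "b \<in> carrier A" "r \<in> carrier R" "m \<in> carrier M" by blast
    then show "x \<in> carrier (tensor_free A M)"
      using keys2[of "(b \<otimes>\<^bsub>A\<^esub> \<iota> r, m)" "(b, r \<odot>\<^bsub>M\<^esub> m)"] smult_M[of r m] iota_closed[of r]
      by (auto simp: tensor_free_def)
  qed
qed

lemma Rel_zero: "0 \<in> Rel"
  using subgroup.one_closed[OF Rel_subgroup] by (simp add: tensor_free_def)

lemma Rel_add: "x \<in> Rel \<Longrightarrow> y \<in> Rel \<Longrightarrow> x + y \<in> Rel"
  using subgroup.m_closed[OF Rel_subgroup, of x y] by (simp add: tensor_free_def)

lemma Rel_uminus: assumes "x \<in> Rel" shows "- x \<in> Rel"
proof -
  have "x \<in> carrier (tensor_free A M)" using subgroup.mem_carrier[OF Rel_subgroup assms] .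
  then show ?thesis
    using subgroup.m_inv_closed[OF Rel_subgroup assms] by (simp add: tensor_free_def)
qed

lemma Rel_diff: "x \<in> Rel \<Longrightarrow> y \<in> Rel \<Longrightarrow> x - y \<in> Rel"
  using Rel_add[OF _ Rel_uminus, of x y] by simp

lemma Rel_sum: "(\<And>i. i \<in> I \<Longrightarrow> x i \<in> Rel) \<Longrightarrow> sum x I \<in> Rel"
  by (induction I rule: infinite_finite_induct) (auto intro: Rel_zero Rel_add)

lemma Rel_left_add:
  "\<lbrakk>b \<in> carrier A; b' \<in> carrier A; m \<in> carrier M\<rbrakk> \<Longrightarrow>
    frag_of (b \<oplus>\<^bsub>A\<^esub> b', m) - frag_of (b, m) - frag_of (b', m) \<in> Rel"
  unfolding tensor_relations_def by (rule generate.incl) blast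

lemma Rel_right_add:
  "\<lbrakk>b \<in> carrier A; m \<in> carrier M; m' \<in> carrier M\<rbrakk> \<Longrightarrow>
    frag_of (b, m \<oplus>\<^bsub>M\<^esub> m') - frag_of (b, m) - frag_of (b, m') \<in> Rel"
  unfolding tensor_relations_def by (rule generate.incl) blast

lemma Rel_balanced:
  "\<lbrakk>b \<in> carrier A; r \<in> carrier R; m \<in> carrier M\<rbrakk> \<Longrightarrow>
    frag_of (b \<otimes>\<^bsub>A\<^esub> \<iota> r, m) - frag_of (b, r \<odot>\<^bsub>M\<^esub> m) \<in> Rel"
  unfolding tensor_relations_def by (rule generate.incl) blast

lemma Rel_left_zero:
  assumes "m \<in> carrier M" shows "frag_of (\<zero>\<^bsub>A\<^esub>, m) \<in> Rel"
  using Rel_uminus[OF Rel_left_add[of "\<zero>\<^bsub>A\<^esub>" "\<zero>\<^bsub>A\<^esub>" m]] assms by simp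

lemma Rel_left_finsum:
  assumes "finite I" "\<And>i. i \<in> I \<Longrightarrow> a i \<in> carrier A" and m: "m \<in> carrier M"
  shows "frag_of (\<Oplus>\<^bsub>A\<^esub>i\<in>I. a i, m) - (\<Sum>i\<in>I. frag_of (a i, m)) \<in> Rel"
  using assms(1,2)
proof (induction I rule: finite_induct)
  case empty then show ?case using Rel_left_zero[OF m] by simp
next
  case (insert i I)
  have c: "(\<Oplus>\<^bsub>A\<^esub>i\<in>I. a i) \<in> carrier A" using insert by (intro A.finsum_closed) auto
  have "(\<Oplus>\<^bsub>A\<^esub>i\<in>insert i I. a i) = a i \<oplus>\<^bsub>A\<^esub> (\<Oplus>\<^bsub>A\<^esub>i\<in>I. a i)"
    using insert by (intro A.finsum_insert) auto
  then show ?case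
    using Rel_add[OF Rel_left_add[OF _ c m, of "a i"] insert.IH] insert by (simp add: algebra_simps)
qed

end

lemma hom_regular_iff:
  "h \<in> carrier (hom_module R P (regular_module R)) \<longleftrightarrow>
    h \<in> mod_hom R P (regular_module R) \<and> h \<in> extensional (carrier P)"
  by (simp add: hom_module_def)

lemma mod_hom_regular:
  assumes "h \<in> mod_hom R P (regular_module R)"
  shows "x \<in> carrier P \<Longrightarrow> h x \<in> carrier R"
    "x \<in> carrier P \<Longrightarrow> y \<in> carrier P \<Longrightarrow> h (x \<oplus>\<^bsub>P\<^esub> y) = h x \<oplus>\<^bsub>R\<^esub> h y"
    "r \<in> carrier R \<Longrightarrow> x \<in> carrier P \<Longrightarrow> h (r \<odot>\<^bsub>P\<^esub> x) = r \<otimes>\<^bsub>R\<^esub> h x"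
  using assms by (auto simp: mod_hom_def regular_module_simps)

lemma hom_regular_closed:
  assumes R: "cring R" and P: "module R P"
  shows "\<lbrakk>g \<in> carrier (hom_module R P (regular_module R)); h \<in> carrier (hom_module R P (regular_module R))\<rbrakk>
      \<Longrightarrow> g \<oplus>\<^bsub>hom_module R P (regular_module R)\<^esub> h \<in> carrier (hom_module R P (regular_module R))"
    and "\<lbrakk>r \<in> carrier R; h \<in> carrier (hom_module R P (regular_module R))\<rbrakk>
      \<Longrightarrow> r \<odot>\<^bsub>hom_module R P (regular_module R)\<^esub> h \<in> carrier (hom_module R P (regular_module R))"
    and "(\<lambda>x\<in>carrier P. \<zero>\<^bsub>R\<^esub>) \<in> carrier (hom_module R P (regular_module R))"
proof -
  interpret R: cring R by fact
  interpret P: module R P by fact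
  have swap4: "a \<oplus>\<^bsub>R\<^esub> b \<oplus>\<^bsub>R\<^esub> (c \<oplus>\<^bsub>R\<^esub> d) = a \<oplus>\<^bsub>R\<^esub> c \<oplus>\<^bsub>R\<^esub> (b \<oplus>\<^bsub>R\<^esub> d)"
    if "a \<in> carrier R" "b \<in> carrier R" "c \<in> carrier R" "d \<in> carrier R" for a b c d
    using that by (simp add: R.a_ac)
  show "g \<oplus>\<^bsub>hom_module R P (regular_module R)\<^esub> h \<in> carrier (hom_module R P (regular_module R))"
    if "g \<in> carrier (hom_module R P (regular_module R))" "h \<in> carrier (hom_module R P (regular_module R))"
    using that
    by (auto simp: hom_module_def mod_hom_def regular_module_simps Pi_iff R.r_distr intro!: swap4)
  show "r \<odot>\<^bsub>hom_module R P (regular_module R)\<^esub> h \<in> carrier (hom_module R P (regular_module R))"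
    if "r \<in> carrier R" "h \<in> carrier (hom_module R P (regular_module R))"
    using that
    by (auto simp: hom_module_def mod_hom_def regular_module_simps Pi_iff R.r_distr intro!: R.m_lcomm)
  show "(\<lambda>x\<in>carrier P. \<zero>\<^bsub>R\<^esub>) \<in> carrier (hom_module R P (regular_module R))"
    by (auto simp: hom_module_def mod_hom_def regular_module_simps)
qed

locale tensor_hom_setting = R?: cring R + A: cring A + P: module R P
  for R :: "('a, 'x) ring_scheme" (structure) and A :: "('l, 'z) ring_scheme" and \<iota> :: "'a \<Rightarrow> 'l"
    and P :: "('a, 'm) module" +
  assumes hom': "\<iota> \<in> ring_hom R A"
begin

abbreviation "H \<equiv> hom_module R P (regular_module R)"

sublocale T: tensor_setting R A \<iota> H
  by unfold_locales
    (auto intro: hom_regular_closed[OF R.cring_axioms P.module_axioms] hom')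

lemma tensor_hom_expansion:
  assumes b: "b \<in> carrier A" and "finite K" "\<And>j. j \<in> K \<Longrightarrow> c j \<in> carrier R" "\<And>j. j \<in> K \<Longrightarrow> \<xi> j \<in> carrier H"
  shows "(\<lambda>x\<in>carrier P. \<Oplus>j\<in>K. c j \<otimes> \<xi> j x) \<in> carrier H \<and>
    frag_of (b, \<lambda>x\<in>carrier P. \<Oplus>j\<in>K. c j \<otimes> \<xi> j x) -
      (\<Sum>j\<in>K. frag_of (b \<otimes>\<^bsub>A\<^esub> \<iota> (c j), \<xi> j)) \<in> T.Rel"
  using assms(2-)
proof (induction K rule: finite_induct)
  case empty
  let ?z = "\<lambda>x\<in>carrier P. \<zero>"
  have z: "?z \<in> carrier H" by (rule hom_regular_closed(3)) unfold_locales
  have "?z \<oplus>\<^bsub>H\<^esub> ?z = ?z"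
    by (auto simp: hom_module_def regular_module_simps fun_eq_iff)
  then have "frag_of (b, ?z) \<in> T.Rel"
    using T.Rel_uminus[OF T.Rel_right_add[OF b z z]] by simp
  then show ?case using z by (simp only: R.finsum_empty sum.empty diff_zero simp_thms)
next
  case (insert k K)
  let ?h = "\<lambda>K. \<lambda>x\<in>carrier P. \<Oplus>j\<in>K. c j \<otimes> \<xi> j x"
  have "?h K \<in> carrier H \<and>
      frag_of (b, ?h K) - (\<Sum>j\<in>K. frag_of (b \<otimes>\<^bsub>A\<^esub> \<iota> (c j), \<xi> j)) \<in> T.Rel"
    by (rule insert.IH) (rule insert.prems, rule insertI2, assumption)+
  note IH = conjunct1[OF this] conjunct2[OF this]
  have ck: "c k \<in> carrier R" "\<xi> k \<in> carrier H" using insert by auto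
  have ks: "c k \<odot>\<^bsub>H\<^esub> \<xi> k \<in> carrier H" using T.smult_M[OF ck] .
  have \<xi>R: "\<xi> j x \<in> carrier R" if "j \<in> insert k K" "x \<in> carrier P" for j x
    using insert.prems(2)[OF that(1)] that(2) mod_hom_regular(1) by (auto simp: hom_regular_iff)
  have eq: "?h (insert k K) = (c k \<odot>\<^bsub>H\<^esub> \<xi> k) \<oplus>\<^bsub>H\<^esub> ?h K"
  proof
    fix x
    show "?h (insert k K) x = ((c k \<odot>\<^bsub>H\<^esub> \<xi> k) \<oplus>\<^bsub>H\<^esub> ?h K) x"
    proof (cases "x \<in> carrier P")
      case True
      then have "(\<Oplus>j\<in>insert k K. c j \<otimes> \<xi> j x) = c k \<otimes> \<xi> k x \<oplus> (\<Oplus>j\<in>K. c j \<otimes> \<xi> j x)"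
        using insert \<xi>R by (intro R.finsum_insert) auto
      then show ?thesis using True by (simp add: hom_module_def regular_module_simps)
    qed (simp add: hom_module_def)
  qed
  have split: "frag_of (b, ?h (insert k K)) - frag_of (b, c k \<odot>\<^bsub>H\<^esub> \<xi> k) - frag_of (b, ?h K) \<in> T.Rel"
    unfolding eq by (rule T.Rel_right_add[OF b ks IH(1)])
  have balance: "frag_of (b \<otimes>\<^bsub>A\<^esub> \<iota> (c k), \<xi> k) - frag_of (b, c k \<odot>\<^bsub>H\<^esub> \<xi> k) \<in> T.Rel"
    by (rule T.Rel_balanced[OF b ck])
  have "frag_of (b, ?h (insert k K)) -
      (\<Sum>j\<in>insert k K. frag_of (b \<otimes>\<^bsub>A\<^esub> \<iota> (c j), \<xi> j)) \<in> T.Rel"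
    using T.Rel_add[OF T.Rel_diff[OF split balance] IH(2)] insert.hyps
    by (simp add: algebra_simps)
  moreover have "?h (insert k K) \<in> carrier H" unfolding eq by (rule T.add_M[OF ks IH(1)])
  ultimately show ?case by blast
qed

text \<open>The natural map from \<open>A \<otimes> Hom(P, R)\<close> to \<open>Hom(P, A)\<close> is injective when \<open>P\<close> has a finite dual basis: all
  forms are expanded in the coordinate forms \<open>\<xi> j\<close>, after which only the values at the \<open>g j\<close> matter.\<close>

lemma tensor_hom_eqI:
  assumes db: "finite_dual_basis R P J g \<xi>"
    and b: "b \<in> carrier A" and h: "h \<in> carrier H"
    and I: "finite I" "\<And>i. i \<in> I \<Longrightarrow> a i \<in> carrier A" "\<And>i. i \<in> I \<Longrightarrow> w i \<in> carrier H"
    and eq: "\<And>y. y \<in> carrier P \<Longrightarrow> b \<otimes>\<^bsub>A\<^esub> \<iota> (h y) = (\<Oplus>\<^bsub>A\<^esub>i\<in>I. a i \<otimes>\<^bsub>A\<^esub> \<iota> (w i y))"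
  shows "frag_of (b, h) - (\<Sum>i\<in>I. frag_of (a i, w i)) \<in> T.Rel"
proof -
  have J: "finite J" "\<And>j. j \<in> J \<Longrightarrow> g j \<in> carrier P" "\<And>j. j \<in> J \<Longrightarrow> \<xi> j \<in> carrier H"
      "\<And>x. x \<in> carrier P \<Longrightarrow> x = (\<Oplus>\<^bsub>P\<^esub>j\<in>J. \<xi> j x \<odot>\<^bsub>P\<^esub> g j)"
    using db by (auto simp: finite_dual_basis_def)
  have HR: "u x \<in> carrier R" if "u \<in> carrier H" "x \<in> carrier P" for u x
    using that mod_hom_regular(1) by (auto simp: hom_regular_iff)
  have expand: "frag_of (d, u) - (\<Sum>j\<in>J. frag_of (d \<otimes>\<^bsub>A\<^esub> \<iota> (u (g j)), \<xi> j)) \<in> T.Rel"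
    if d: "d \<in> carrier A" and u: "u \<in> carrier H" for d u
  proof -
    have "u = (\<lambda>x\<in>carrier P. \<Oplus>j\<in>J. u (g j) \<otimes> \<xi> j x)"
    proof
      fix x show "u x = (\<lambda>x\<in>carrier P. \<Oplus>j\<in>J. u (g j) \<otimes> \<xi> j x) x"
      proof (cases "x \<in> carrier P")
        case True
        have "u x = u (\<Oplus>\<^bsub>P\<^esub>j\<in>J. \<xi> j x \<odot>\<^bsub>P\<^esub> g j)" by (rule arg_cong[OF J(4)[OF True]])
        also have "\<dots> = (\<Oplus>j\<in>J. \<xi> j x \<otimes> u (g j))"
          using mod_hom_finsum[OF P.module_axioms regular_module_module[OF R.cring_axioms], of u J "\<lambda>j. \<xi> j x" g]
            u J HR True by (simp add: hom_regular_iff regular_module_simps)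
        also have "\<dots> = (\<Oplus>j\<in>J. u (g j) \<otimes> \<xi> j x)"
          by (rule R.finsum_cong') (use J HR True u in \<open>auto simp: R.m_comm\<close>)
        finally show ?thesis using True by simp
      next
        case False
        then show ?thesis using u by (auto simp: hom_regular_iff extensional_def)
      qed
    qed
    moreover have "frag_of (d, \<lambda>x\<in>carrier P. \<Oplus>j\<in>J. u (g j) \<otimes> \<xi> j x) -
        (\<Sum>j\<in>J. frag_of (d \<otimes>\<^bsub>A\<^esub> \<iota> (u (g j)), \<xi> j)) \<in> T.Rel"
      using tensor_hom_expansion[OF d J(1), of "\<lambda>j. u (g j)" \<xi>] J HR u by auto
    ultimately show ?thesis by simp
  qed
  have 1: "frag_of (b, h) - (\<Sum>j\<in>J. frag_of (b \<otimes>\<^bsub>A\<^esub> \<iota> (h (g j)), \<xi> j)) \<in> T.Rel"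
    by (rule expand[OF b h])
  have 2: "(\<Sum>j\<in>J. frag_of (b \<otimes>\<^bsub>A\<^esub> \<iota> (h (g j)), \<xi> j) - (\<Sum>i\<in>I. frag_of (a i \<otimes>\<^bsub>A\<^esub> \<iota> (w i (g j)), \<xi> j))) \<in> T.Rel"
  proof (rule T.Rel_sum)
    fix j assume j: "j \<in> J"
    show "frag_of (b \<otimes>\<^bsub>A\<^esub> \<iota> (h (g j)), \<xi> j) - (\<Sum>i\<in>I. frag_of (a i \<otimes>\<^bsub>A\<^esub> \<iota> (w i (g j)), \<xi> j)) \<in> T.Rel"
      unfolding eq[OF J(2)[OF j]]
      by (rule T.Rel_left_finsum) (use I J j HR T.iota_closed in auto)
  qed
  have 3: "(\<Sum>i\<in>I. frag_of (a i, w i) - (\<Sum>j\<in>J. frag_of (a i \<otimes>\<^bsub>A\<^esub> \<iota> (w i (g j)), \<xi> j))) \<in> T.Rel"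
    by (rule T.Rel_sum) (use expand I in auto)
  have "(\<Sum>j\<in>J. \<Sum>i\<in>I. frag_of (a i \<otimes>\<^bsub>A\<^esub> \<iota> (w i (g j)), \<xi> j)) =
      (\<Sum>i\<in>I. \<Sum>j\<in>J. frag_of (a i \<otimes>\<^bsub>A\<^esub> \<iota> (w i (g j)), \<xi> j))"
    by (rule sum.swap)
  then show ?thesis
    using T.Rel_diff[OF T.Rel_add[OF 1 2] 3] by (simp add: sum_subtractf)
qed

end

text \<open>A linear combination of pure tensors with second factors in \<open>W\<close> is the image of the same formal sum in
  the base change of \<open>W\<close>; the summand among the multiples of \<open>k\<close> is \<open>0\<close>.\<close>

lemma pure_tensor_in_image:
  assumes M: "tensor_setting R A \<iota> M" and N: "tensor_setting R A \<iota> (M\<lparr>carrier := W\<rparr>)"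
    and W: "W \<subseteq> carrier M" and b: "b \<in> carrier A" and u: "u \<in> carrier M"
    and I: "\<And>i. i \<in> I \<Longrightarrow> a i \<in> carrier A" "\<And>i. i \<in> I \<Longrightarrow> w i \<in> W"
    and eq: "frag_of (b, u) - (\<Sum>i\<in>I. frag_of (a i, w i)) \<in> tensor_relations R A \<iota> M"
  shows "pure_tensor R A \<iota> M b u \<in>
    base_change_map R A \<iota> M (\<lambda>w. w) ` carrier (base_change R A \<iota> (M\<lparr>carrier := W\<rparr>))
      <#>\<^bsub>base_change R A \<iota> M\<^esub>
    (\<lambda>x. x [^]\<^bsub>base_change R A \<iota> M\<^esub> (k::nat)) ` carrier (base_change R A \<iota> M)"
proof -
  interpret M: tensor_setting R A \<iota> M by fact
  interpret N: tensor_setting R A \<iota> "M\<lparr>carrier := W\<rparr>" by fact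
  let ?F = "tensor_free A M"
  interpret F: comm_group ?F by (simp add: tensor_free_def abelian_free_Abelian_group)
  have normal: "M.Rel \<lhd> ?F" by (rule F.subgroup_imp_normal[OF M.Rel_subgroup])
  interpret Q: group "base_change R A \<iota> M"
    unfolding base_change_def by (rule normal.factorgroup_is_group[OF normal])
  have sub: "N.Rel \<subseteq> M.Rel"
  proof
    fix x assume "x \<in> N.Rel"
    then show "x \<in> M.Rel" unfolding tensor_relations_def[of R A \<iota> "M\<lparr>carrier := W\<rparr>"]
    proof (induction rule: generate.induct)
      case one then show ?case using M.Rel_zero by (simp add: tensor_free_def)
    next
      case (incl h)
      then show ?case using W M.Rel_left_add M.Rel_right_add M.Rel_balanced by (auto simp: subset_iff)
    next
      case (inv h)
      then have "h \<in> N.Rel" unfolding tensor_relations_def[of R A \<iota> "M\<lparr>carrier := W\<rparr>"]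
        by (rule generate.incl)
      then have "h \<in> carrier (tensor_free A (M\<lparr>carrier := W\<rparr>))"
        by (rule subgroup.mem_carrier[OF N.Rel_subgroup])
      then have "inv\<^bsub>tensor_free A (M\<lparr>carrier := W\<rparr>)\<^esub> h = - h" by (simp add: tensor_free_def)
      moreover have "h \<in> M.Rel"
        using inv W M.Rel_left_add M.Rel_right_add M.Rel_balanced by (auto simp: subset_iff)
      ultimately show ?case using M.Rel_uminus by simp
    next
      case (eng h1 h2) then show ?case using M.Rel_add by (simp add: tensor_free_def)
    qed
  qed
  define V where "V = (\<Sum>i\<in>I. frag_of (a i, w i))"
  have VN: "V \<in> carrier (tensor_free A (M\<lparr>carrier := W\<rparr>))"
    unfolding V_def tensor_free_def by (rule sum_closed_free_Abelian_group) (use I in auto)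
  have coset: "M.Rel #>\<^bsub>?F\<^esub> x = M.Rel #>\<^bsub>?F\<^esub> y" if "x - y \<in> M.Rel" for x y
  proof -
    have coset_eq: "M.Rel #>\<^bsub>?F\<^esub> v = {z + v | z. z \<in> M.Rel}" for v
      by (auto simp: r_coset_def tensor_free_def)
    have "z + x = (z + (x - y)) + y" "z + y = (z - (x - y)) + x" for z by simp_all
    then show ?thesis using M.Rel_add[OF _ that] M.Rel_diff[OF _ that] unfolding coset_eq by blast
  qed
  let ?C = "N.Rel #>\<^bsub>tensor_free A (M\<lparr>carrier := W\<rparr>)\<^esub> V"
  have C: "?C \<in> carrier (base_change R A \<iota> (M\<lparr>carrier := W\<rparr>))"
    using VN by (auto simp: base_change_def carrier_FactGroup)
  have "base_change_map R A \<iota> M (\<lambda>w. w) ?C = M.Rel #>\<^bsub>?F\<^esub> V"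
  proof -
    have "frag_extend (\<lambda>(b, m). frag_of (b, m)) x = x" for x :: "('c \<times> 'e) \<Rightarrow>\<^sub>0 int"
      using frag_expansion[of x] by (simp add: case_prod_unfold)
    then have "base_change_map R A \<iota> M (\<lambda>w. w) ?C = (\<Union>x\<in>?C. M.Rel #>\<^bsub>?F\<^esub> x)"
      by (simp add: base_change_map_def)
    also have "\<dots> = (\<Union>x\<in>?C. M.Rel #>\<^bsub>?F\<^esub> V)"
    proof (rule SUP_cong[OF refl])
      fix x assume "x \<in> ?C"
      then obtain r where "r \<in> N.Rel" "x = r + V" by (auto simp: r_coset_def tensor_free_def)
      then show "M.Rel #>\<^bsub>?F\<^esub> x = M.Rel #>\<^bsub>?F\<^esub> V" using sub by (intro coset) auto
    qed
    also have "\<dots> = M.Rel #>\<^bsub>?F\<^esub> V"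
    proof -
      have "0 + V \<in> ?C" using N.Rel_zero by (force simp: r_coset_def tensor_free_def)
      then show ?thesis by blast
    qed
    finally show ?thesis .
  qed
  also have "M.Rel #>\<^bsub>?F\<^esub> V = pure_tensor R A \<iota> M b u"
    unfolding pure_tensor_def using coset[OF eq] by (simp add: V_def)
  finally have im: "pure_tensor R A \<iota> M b u \<in>
      base_change_map R A \<iota> M (\<lambda>w. w) ` carrier (base_change R A \<iota> (M\<lparr>carrier := W\<rparr>))"
    using C by (metis imageI)
  have car: "pure_tensor R A \<iota> M b u \<in> carrier (base_change R A \<iota> M)"
    unfolding pure_tensor_def base_change_def carrier_FactGroup using b u
    by (intro imageI) (simp add: tensor_free_def)
  have one: "\<one>\<^bsub>base_change R A \<iota> M\<^esub> \<in> (\<lambda>x. x [^]\<^bsub>base_change R A \<iota> M\<^esub> k) ` carrier (base_change R A \<iota> M)"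
    using Q.one_closed Q.nat_pow_one[of k] by (metis imageI)
  have "pure_tensor R A \<iota> M b u = pure_tensor R A \<iota> M b u \<otimes>\<^bsub>base_change R A \<iota> M\<^esub> \<one>\<^bsub>base_change R A \<iota> M\<^esub>"
    using car by simp
  then show ?thesis unfolding set_mult_def using im one by blast
qed

text \<open>If \<open>\<eta>\<close> becomes the pullback of a linear map \<open>\<theta> : P \<rightarrow> A\<close>, then expanding \<open>\<theta>\<close> in the dual basis of \<open>P\<close>
  gives \<open>z \<otimes> \<eta> = \<Sum>\<^sub>j z \<theta>(g\<^sub>j) \<otimes> (\<xi>\<^sub>j \<circ> \<delta>)\<close>.\<close>

lemma pullback_tensor_in_coboundaries:
  fixes P :: "('a, 'm) module" and P' :: "('a, 'n) module"
  assumes R: "cring R" and A: "cring A" and \<iota>: "\<iota> \<in> ring_hom R A"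
    and P: "module R P" "finite_dual_basis R P J g \<xi>"
    and P': "module R P'" "finite_dual_basis R P' J' g' \<xi>'"
    and \<delta>: "\<delta> \<in> mod_hom R P' P" and \<eta>: "\<eta> \<in> carrier (hom_module R P' (regular_module R))"
    and \<theta>: "\<theta> \<in> mod_hom R P (restrict_scalars A \<iota>)"
    and lift: "\<And>y. y \<in> carrier P' \<Longrightarrow> \<iota> (\<eta> y) = \<theta> (\<delta> y)"
    and z: "z \<in> carrier A"
    and M_def: "M = hom_module R P' (regular_module R)"
    and W_def: "W = (\<lambda>h. \<lambda>x\<in>carrier P'. h (\<delta> x)) ` carrier (hom_module R P (regular_module R))"
  shows "pure_tensor R A \<iota> M z \<eta> \<in>
    base_change_map R A \<iota> M (\<lambda>w. w) ` carrier (base_change R A \<iota> (M\<lparr>carrier := W\<rparr>))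
      <#>\<^bsub>base_change R A \<iota> M\<^esub>
    (\<lambda>x. x [^]\<^bsub>base_change R A \<iota> M\<^esub> (k::nat)) ` carrier (base_change R A \<iota> M)"
proof -
  interpret R: cring R by fact
  interpret A: cring A by fact
  interpret P: module R P by fact
  interpret P': module R P' by fact
  interpret TH: tensor_hom_setting R A \<iota> P'
    by (rule tensor_hom_setting.intro[OF R A P'(1)]) (unfold tensor_hom_setting_axioms_def, rule \<iota>)
  let ?H = "hom_module R P (regular_module R)"
  have \<delta>P: "\<delta> y \<in> carrier P" if "y \<in> carrier P'" for y using \<delta> that by (auto simp: mod_hom_def)
  define pull where "pull h = (\<lambda>x\<in>carrier P'. h (\<delta> x))" for h :: "'m \<Rightarrow> 'a"
  have W: "W = pull ` carrier ?H" unfolding W_def pull_def ..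
  have pull_M: "pull h \<in> carrier M" if "h \<in> carrier ?H" for h
  proof -
    have h: "h \<in> mod_hom R P (regular_module R)" using that by (simp add: hom_regular_iff)
    have "\<delta> (x \<oplus>\<^bsub>P'\<^esub> y) = \<delta> x \<oplus>\<^bsub>P\<^esub> \<delta> y" if "x \<in> carrier P'" "y \<in> carrier P'" for x y
      using \<delta> that by (simp add: mod_hom_def)
    moreover have "\<delta> (r \<odot>\<^bsub>P'\<^esub> x) = r \<odot>\<^bsub>P\<^esub> \<delta> x" if "r \<in> carrier R" "x \<in> carrier P'" for r x
      using \<delta> that by (simp add: mod_hom_def)
    ultimately show ?thesis
      unfolding M_def hom_regular_iff mod_hom_def[of R P'] pull_def
      by (simp add: regular_module_simps mod_hom_regular[OF h] \<delta>P)
  qed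
  have WM: "W \<subseteq> carrier M" unfolding W using pull_M by (rule image_subsetI)
  have pull_add: "pull h \<oplus>\<^bsub>M\<^esub> pull h' = pull (h \<oplus>\<^bsub>?H\<^esub> h')" for h h'
  proof
    fix x show "(pull h \<oplus>\<^bsub>M\<^esub> pull h') x = pull (h \<oplus>\<^bsub>?H\<^esub> h') x"
      using \<delta>P[of x] by (simp add: M_def hom_module_def pull_def)
  qed
  have pull_smult: "r \<odot>\<^bsub>M\<^esub> pull h = pull (r \<odot>\<^bsub>?H\<^esub> h)" for r h
  proof
    fix x show "(r \<odot>\<^bsub>M\<^esub> pull h) x = pull (r \<odot>\<^bsub>?H\<^esub> h) x"
      using \<delta>P[of x] by (simp add: M_def hom_module_def pull_def)
  qed
  have setting_M: "tensor_setting R A \<iota> M"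
    unfolding M_def by (rule TH.T.tensor_setting_axioms)
  have setting_W: "tensor_setting R A \<iota> (M\<lparr>carrier := W\<rparr>)"
  proof (rule tensor_setting.intro[OF R A], rule tensor_setting_axioms.intro[OF \<iota>])
    show "x \<oplus>\<^bsub>M\<lparr>carrier := W\<rparr>\<^esub> y \<in> carrier (M\<lparr>carrier := W\<rparr>)"
      if xy: "x \<in> carrier (M\<lparr>carrier := W\<rparr>)" "y \<in> carrier (M\<lparr>carrier := W\<rparr>)" for x y
    proof -
      obtain h h' where "x = pull h" "h \<in> carrier ?H" "y = pull h'" "h' \<in> carrier ?H"
        using xy unfolding W by auto
      then show ?thesis unfolding W using hom_regular_closed(1)[OF R P(1)] pull_add by simp
    qed
    show "r \<odot>\<^bsub>M\<lparr>carrier := W\<rparr>\<^esub> x \<in> carrier (M\<lparr>carrier := W\<rparr>)"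
      if rx: "r \<in> carrier R" "x \<in> carrier (M\<lparr>carrier := W\<rparr>)" for r x
    proof -
      obtain h where "x = pull h" "h \<in> carrier ?H" using rx(2) unfolding W by auto
      then show ?thesis unfolding W using hom_regular_closed(2)[OF R P(1) rx(1)] pull_smult by simp
    qed
  qed
  have J: "finite J" "\<And>j. j \<in> J \<Longrightarrow> g j \<in> carrier P" "\<And>j. j \<in> J \<Longrightarrow> \<xi> j \<in> carrier ?H"
      "\<And>x. x \<in> carrier P \<Longrightarrow> x = (\<Oplus>\<^bsub>P\<^esub>j\<in>J. \<xi> j x \<odot>\<^bsub>P\<^esub> g j)"
    using P(2) by (auto simp: finite_dual_basis_def)
  have \<xi>R: "\<xi> j x \<in> carrier R" if "j \<in> J" "x \<in> carrier P" for j x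
    using J(3)[OF that(1)] mod_hom_regular(1) that(2) by (auto simp: hom_regular_iff)
  have \<theta>A: "\<theta> x \<in> carrier A" if "x \<in> carrier P" for x
    using \<theta> that by (auto simp: mod_hom_def restrict_scalars_simps)
  have \<iota>A: "\<iota> r \<in> carrier A" if "r \<in> carrier R" for r using ring_hom_closed[OF \<iota> that] .
  have \<theta>_expand: "\<theta> x = (\<Oplus>\<^bsub>A\<^esub>j\<in>J. \<iota> (\<xi> j x) \<otimes>\<^bsub>A\<^esub> \<theta> (g j))" if x: "x \<in> carrier P" for x
  proof -
    have "\<theta> x = \<theta> (\<Oplus>\<^bsub>P\<^esub>j\<in>J. \<xi> j x \<odot>\<^bsub>P\<^esub> g j)" by (rule arg_cong[OF J(4)[OF x]])
    also have "\<dots> = (\<Oplus>\<^bsub>restrict_scalars A \<iota>\<^esub>j\<in>J. \<xi> j x \<odot>\<^bsub>restrict_scalars A \<iota>\<^esub> \<theta> (g j))"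
      by (rule mod_hom_finsum[OF P(1) restrict_scalars_module[OF R A \<iota>] \<theta> J(1)])
        (use \<xi>R[OF _ x] J(2) in auto)
    also have "\<dots> = (\<Oplus>\<^bsub>A\<^esub>j\<in>J. \<iota> (\<xi> j x) \<otimes>\<^bsub>A\<^esub> \<theta> (g j))"
      by (simp only: finsum_restrict_scalars restrict_scalars_simps)
    finally show ?thesis .
  qed
  have eq: "z \<otimes>\<^bsub>A\<^esub> \<iota> (\<eta> y) = (\<Oplus>\<^bsub>A\<^esub>j\<in>J. (z \<otimes>\<^bsub>A\<^esub> \<theta> (g j)) \<otimes>\<^bsub>A\<^esub> \<iota> (pull (\<xi> j) y))"
    if y: "y \<in> carrier P'" for y
  proof -
    have "z \<otimes>\<^bsub>A\<^esub> \<iota> (\<eta> y) = z \<otimes>\<^bsub>A\<^esub> (\<Oplus>\<^bsub>A\<^esub>j\<in>J. \<iota> (\<xi> j (\<delta> y)) \<otimes>\<^bsub>A\<^esub> \<theta> (g j))"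
      unfolding lift[OF y] \<theta>_expand[OF \<delta>P[OF y]] ..
    also have "\<dots> = (\<Oplus>\<^bsub>A\<^esub>j\<in>J. z \<otimes>\<^bsub>A\<^esub> (\<iota> (\<xi> j (\<delta> y)) \<otimes>\<^bsub>A\<^esub> \<theta> (g j)))"
      by (rule A.finsum_rdistr[OF J(1) z]) (intro Pi_I A.m_closed \<iota>A \<xi>R \<theta>A J(2) \<delta>P y)
    also have "\<dots> = (\<Oplus>\<^bsub>A\<^esub>j\<in>J. (z \<otimes>\<^bsub>A\<^esub> \<theta> (g j)) \<otimes>\<^bsub>A\<^esub> \<iota> (pull (\<xi> j) y))"
    proof (rule A.finsum_cong'[OF refl])
      show "(\<lambda>j. (z \<otimes>\<^bsub>A\<^esub> \<theta> (g j)) \<otimes>\<^bsub>A\<^esub> \<iota> (pull (\<xi> j) y)) \<in> J \<rightarrow> carrier A"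
        unfolding pull_def restrict_apply'[OF y] by (intro Pi_I A.m_closed \<iota>A \<xi>R \<theta>A J(2) \<delta>P y z)
      show "z \<otimes>\<^bsub>A\<^esub> (\<iota> (\<xi> j (\<delta> y)) \<otimes>\<^bsub>A\<^esub> \<theta> (g j)) = (z \<otimes>\<^bsub>A\<^esub> \<theta> (g j)) \<otimes>\<^bsub>A\<^esub> \<iota> (pull (\<xi> j) y)" if "j \<in> J" for j
        unfolding pull_def restrict_apply'[OF y]
        using A.m_comm[OF \<iota>A[OF \<xi>R[OF that \<delta>P[OF y]]] \<theta>A[OF J(2)[OF that]]]
          A.m_assoc[OF z \<theta>A[OF J(2)[OF that]] \<iota>A[OF \<xi>R[OF that \<delta>P[OF y]]]] by simp
    qed
    finally show ?thesis .
  qed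
  have zA: "z \<otimes>\<^bsub>A\<^esub> \<theta> (g j) \<in> carrier A" if "j \<in> J" for j
    by (rule A.m_closed[OF z \<theta>A[OF J(2)[OF that]]])
  have \<eta>M: "\<eta> \<in> carrier M" unfolding M_def by (rule \<eta>)
  have key: "frag_of (z, \<eta>) - (\<Sum>j\<in>J. frag_of (z \<otimes>\<^bsub>A\<^esub> \<theta> (g j), pull (\<xi> j))) \<in> tensor_relations R A \<iota> M"
    unfolding M_def
    by (rule TH.tensor_hom_eqI[OF P'(2) z \<eta> J(1) zA pull_M[OF J(3), unfolded M_def] eq])
  show ?thesis
    by (rule pure_tensor_in_image[OF setting_M setting_W WM z \<eta>M zA _ key])
      (assumption, unfold W, erule imageI[OF J(3)])
qed

section \<open>Module-finite extensions are phantom\<close>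

lemma (in field) integral_closure_subring:
  assumes K: "subring K R" shows "subring {x \<in> carrier R. integral_over R K x} R"
proof (rule subringI)
  have one: "integral_over R K (\<ominus> \<one>)"
    using integral_over_subring[OF K] subringE(3,5)[OF K] by blast
  show "\<one> \<in> {x \<in> carrier R. integral_over R K x}"
    using integral_over_subring[OF K] subringE(3)[OF K] by blast
  show "\<ominus> x \<in> {x \<in> carrier R. integral_over R K x}" if "x \<in> {x \<in> carrier R. integral_over R K x}" for x
    using integral_over_add_mult(2)[OF K _ one, of x] that by (simp add: l_minus)
qed (use integral_over_add_mult[OF K] in auto)

lemma integral_over_hom_image:
  assumes S: "domain S" and L: "domain L" and \<psi>: "\<psi> \<in> ring_hom S L"
    and K: "K \<subseteq> carrier S" and s: "s \<in> carrier S" "integral_over S K s"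
  shows "integral_over L (\<psi> ` K) (\<psi> s)"
proof -
  interpret S: domain S by fact
  interpret L: domain L by fact
  interpret h: ring_hom_ring S L \<psi> by (rule ring_hom_ringI2[OF S.ring_axioms L.ring_axioms \<psi>])
  obtain q where q: "polynomial\<^bsub>S\<^esub> K q" "q \<noteq> []" "hd q = \<one>\<^bsub>S\<^esub>" "S.eval q s = \<zero>\<^bsub>S\<^esub>"
    using s(2) univ_poly_carrier[of S K] unfolding integral_over_def by blast
  have qK: "set q \<subseteq> K" using q(1,2) by (simp add: polynomial_def)
  have hd: "hd (map \<psi> q) = \<one>\<^bsub>L\<^esub>" using q(2,3) by (simp add: hd_map)
  have "polynomial\<^bsub>L\<^esub> (\<psi> ` K) (map \<psi> q)"
    using qK hd unfolding polynomial_def by (auto simp del: hd_map)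
  moreover have "L.eval (map \<psi> q) (\<psi> s) = \<zero>\<^bsub>L\<^esub>"
    using h.eval_hom'[OF s(1), of q] qK K q(4) by simp
  ultimately show ?thesis
    using q(2) hd univ_poly_carrier[of L "\<psi> ` K"] unfolding integral_over_def by blast
qed

theorem theorem5p1:
  fixes R :: "('a, 'x) ring_scheme" and S :: "('b, 'y) ring_scheme"
    and L :: "('l, 'z) ring_scheme" and f :: "'a \<Rightarrow> 'b" and \<iota> :: "'a \<Rightarrow> 'l" and p :: nat
  assumes "domain R" and "complete_local_ring R" and "mixed_characteristic R p"
    and "domain S" and "complete_local_ring S" and "mixed_characteristic S p"
    and "F_finite (residue_field R) p"
    and "f \<in> ring_hom R S" and "inj_on f (carrier R)"
    and "finitely_generated R (restrict_scalars S f)"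
    and "alg_closure_of_fractions R L \<iota>"
  shows "epf_phantom TYPE('m) p R L \<iota> (restrict_scalars S f) f"
proof -
  interpret R: domain R by fact
  interpret S: domain S by fact
  note f = \<open>f \<in> ring_hom R S\<close> and fg = \<open>finitely_generated R (restrict_scalars S f)\<close>
  have \<iota>L: "\<iota> \<in> ring_hom R L" "inj_on \<iota> (carrier R)"
    and "algebraic_closure L (generate_field L (\<iota> ` carrier R))"
    using \<open>alg_closure_of_fractions R L \<iota>\<close> by (simp_all add: alg_closure_of_fractions_def)
  then interpret L: algebraic_closure L "generate_field L (\<iota> ` carrier R)" by simp
  interpret i: ring_hom_ring R L \<iota> by (rule ring_hom_ringI2[OF R.ring_axioms L.ring_axioms \<iota>L(1)])
  let ?M = "restrict_scalars S f" and ?A = "abs_integral_closure R L \<iota>"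
  have K: "subring (\<iota> ` carrier R) L" by (rule i.img_is_subring[OF R.carrier_is_subring])
  have A_carrier: "carrier ?A = {x \<in> carrier L. integral_over L (\<iota> ` carrier R) x}"
    by (simp add: abs_integral_closure_def)
  have A: "cring ?A"
    unfolding abs_integral_closure_def
    using L.subcring_iff L.subcringI'[OF L.integral_closure_subring[OF K]] by auto
  then interpret A: cring ?A .
  have A_simps: "x \<oplus>\<^bsub>?A\<^esub> y = x \<oplus>\<^bsub>L\<^esub> y" "x \<otimes>\<^bsub>?A\<^esub> y = x \<otimes>\<^bsub>L\<^esub> y" "\<one>\<^bsub>?A\<^esub> = \<one>\<^bsub>L\<^esub>" for x y
    by (simp_all add: abs_integral_closure_def)
  have \<iota>A: "\<iota> \<in> ring_hom R ?A"
  proof (rule ring_hom_memI)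
    show "\<iota> r \<in> carrier ?A" if "r \<in> carrier R" for r
      unfolding A_carrier using L.integral_over_subring[OF K, of "\<iota> r"] that by simp
  qed (simp_all add: A_simps)
  have "\<exists>\<psi>\<in>ring_hom S L. \<forall>r\<in>carrier R. \<psi> (f r) = \<iota> r"
    by (rule extend_hom_to_alg_closed[OF _ _ L.algebraically_closed_axioms f _ \<iota>L fg]) fact+
  then obtain \<psi> where \<psi>: "\<psi> \<in> ring_hom S L" "\<And>r. r \<in> carrier R \<Longrightarrow> \<psi> (f r) = \<iota> r" by auto
  have fR: "f ` carrier R \<subseteq> carrier S" using ring_hom_closed[OF f] by auto
  have \<psi>K: "\<psi> ` f ` carrier R = \<iota> ` carrier R"
    unfolding image_image by (rule image_cong[OF refl \<psi>(2)])
  have \<psi>A: "\<psi> s \<in> carrier ?A" if "s \<in> carrier S" for s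
    using integral_over_hom_image[OF S.domain_axioms L.domain_axioms \<psi>(1) fR that
        finitely_generated_integral[OF R.cring_axioms S.domain_axioms f fg that]]
      ring_hom_closed[OF \<psi>(1) that] unfolding \<psi>K A_carrier by simp
  have phantom: "\<eta> \<in> epf_closure p R L \<iota> (hom_module R (P 1) (regular_module R)) (coboundaries R P d)"
    if res: "fg_projective_resolution R (quotient_module ?M (f ` carrier R)) P d a"
      and rep: "represents_extension R ?M f P d a \<eta>"
    for P :: "nat \<Rightarrow> ('a, 'm) module" and d a \<eta>
  proof -
    have P: "projective_module R (P i)" "finitely_generated R (P i)" for i
      using res by (simp_all add: fg_projective_resolution_def)
    have Pm: "module R (P i)" for i using P(1)[of i] by (simp add: projective_module_def)
    have \<delta>: "d 0 \<in> mod_hom R (P 1) (P 0)"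
      using res by (simp add: fg_projective_resolution_def)
    obtain J g \<xi> where db0: "finite_dual_basis R (P 0) (J :: 'm set) g \<xi>"
      using projective_finite_dual_basis[OF R.cring_axioms P] by blast
    obtain J' g' \<xi>' where db1: "finite_dual_basis R (P 1) (J' :: 'm set) g' \<xi>'"
      using projective_finite_dual_basis[OF R.cring_axioms P] by blast
    have \<eta>: "\<eta> \<in> carrier (hom_module R (P 1) (regular_module R))"
      using rep by (simp add: represents_extension_def)
    obtain \<phi> where \<phi>: "\<phi> \<in> mod_hom R (P 0) ?M" "\<And>x. x \<in> carrier (P 1) \<Longrightarrow> f (\<eta> x) = \<phi> (d 0 x)"
      using rep unfolding represents_extension_def by blast
    have \<phi>S: "\<phi> x \<in> carrier S" if "x \<in> carrier (P 0)" for x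
      using \<phi>(1) that by (auto simp: mod_hom_def restrict_scalars_simps)
    \<comment> \<open>The cochain over \<open>R\<^sup>+\<close> whose coboundary is \<open>\<eta>\<close>.\<close>
    have \<theta>: "(\<lambda>x. \<psi> (\<phi> x)) \<in> mod_hom R (P 0) (restrict_scalars ?A \<iota>)"
      unfolding mod_hom_def restrict_scalars_simps A_simps
    proof (intro CollectI conjI ballI Pi_I)
      show "\<psi> (\<phi> x) \<in> carrier ?A" if "x \<in> carrier (P 0)" for x by (rule \<psi>A[OF \<phi>S[OF that]])
      show "\<psi> (\<phi> (x \<oplus>\<^bsub>P 0\<^esub> y)) = \<psi> (\<phi> x) \<oplus>\<^bsub>L\<^esub> \<psi> (\<phi> y)"
        if "x \<in> carrier (P 0)" "y \<in> carrier (P 0)" for x y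
      proof -
        have "\<phi> (x \<oplus>\<^bsub>P 0\<^esub> y) = \<phi> x \<oplus>\<^bsub>S\<^esub> \<phi> y"
          using \<phi>(1) that by (simp add: mod_hom_def restrict_scalars_simps)
        then show ?thesis using ring_hom_add[OF \<psi>(1) \<phi>S[OF that(1)] \<phi>S[OF that(2)]] by simp
      qed
      show "\<psi> (\<phi> (r \<odot>\<^bsub>P 0\<^esub> x)) = \<iota> r \<otimes>\<^bsub>L\<^esub> \<psi> (\<phi> x)"
        if "r \<in> carrier R" "x \<in> carrier (P 0)" for r x
      proof -
        have "\<phi> (r \<odot>\<^bsub>P 0\<^esub> x) = f r \<otimes>\<^bsub>S\<^esub> \<phi> x"
          using \<phi>(1) that by (simp add: mod_hom_def restrict_scalars_simps)
        then show ?thesis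
          using ring_hom_mult[OF \<psi>(1) ring_hom_closed[OF f that(1)] \<phi>S[OF that(2)]] \<psi>(2)[OF that(1)] by simp
      qed
    qed
    have lift: "\<iota> (\<eta> y) = \<psi> (\<phi> (d 0 y))" if "y \<in> carrier (P 1)" for y
    proof -
      have "\<eta> y \<in> carrier R" using \<eta> mod_hom_regular(1) that by (auto simp: hom_regular_iff)
      then have "\<iota> (\<eta> y) = \<psi> (f (\<eta> y))" by (simp only: \<psi>(2))
      then show ?thesis by (simp only: \<phi>(2)[OF that])
    qed
    show ?thesis
      unfolding epf_closure_def Let_def
    proof (intro CollectI conjI \<eta> bexI[where x = "\<one>\<^bsub>R\<^esub>"] allI impI)
      fix \<epsilon> :: rat and N :: nat and z
      assume "is_rat_power ?A (\<iota> \<one>\<^bsub>R\<^esub>) \<epsilon> z"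
      then obtain a t where "t \<in> carrier ?A" "z = t [^]\<^bsub>?A\<^esub> (a::nat)"
        unfolding is_rat_power_def by blast
      then have z: "z \<in> carrier ?A" by (simp only: A.nat_pow_closed)
      show "pure_tensor R ?A \<iota> (hom_module R (P 1) (regular_module R)) z \<eta>
        \<in> base_change_map R ?A \<iota> (hom_module R (P 1) (regular_module R)) (\<lambda>w. w) `
            carrier (base_change R ?A \<iota> (hom_module R (P 1) (regular_module R)\<lparr>carrier := coboundaries R P d\<rparr>))
          <#>\<^bsub>base_change R ?A \<iota> (hom_module R (P 1) (regular_module R))\<^esub>
          (\<lambda>x. x [^]\<^bsub>base_change R ?A \<iota> (hom_module R (P 1) (regular_module R))\<^esub> (p ^ N)) `
            carrier (base_change R ?A \<iota> (hom_module R (P 1) (regular_module R)))"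
        by (rule pullback_tensor_in_coboundaries[OF R.cring_axioms A \<iota>A Pm db0 Pm db1 \<delta> \<eta> \<theta> lift z refl])
          (simp_all only: coboundaries_def)
    qed simp
  qed
  have "f \<in> mod_hom R (regular_module R) ?M"
    using ring_hom_closed[OF f] ring_hom_add[OF f] ring_hom_mult[OF f]
    by (simp add: mod_hom_def regular_module_simps restrict_scalars_simps)
  with phantom show ?thesis
    unfolding epf_phantom_def
    using restrict_scalars_module[OF R.cring_axioms S.cring_axioms f] fg \<open>inj_on f (carrier R)\<close> by blast
qed

end
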